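(* Consider an RBM with observed variables $X\in\{-1,1\}^n$ as in the context, with parameters $d,s,D,\gamma$. Let $\zeta>0$. Fix an observed variable $u$ and a subset $S\subseteq[n]\setminus\{u\}$. Suppose there exists an MRF neighbor $i$ of $u$ with $i\notin S$ and a set $T\subseteq[n]$ with $u,i\in T$ and $|\hat f(T)|\ge\zeta$. Then there exists a subset $I$ of the MRF neighborhood of $u$ with $|I|\le 2^s$ such that \[\nu_{u,I|S}\ge\frac{1}{(4d)^{2^s}}\left(\frac1d\right)^{2^s(2^s+1)}\frac{4\zeta^2(e^{-2\gamma})^{d+D-1}}{d^{4d}2^{d+1}\binom{D}{d-1}\gamma e^{2\gamma}}.\]
   Context: RBM: $\mathbb{P}(X=x,Y=y)\propto\exp(x^TJy+h^Tx+g^Ty)$ over observed $X\in\{-1,1\}^n$, latent $Y\in\{-1,1\}^m$; $d=\max_j|\{i:J_{i,j}\ne0\}|$. The marginal of $X$ is $\propto\exp(f(x))$, $f(x)=\sum_j\rho(J_j\cdot x+g_j)+h^Tx$, $\rho(t)=\log(e^t+e^{-t})$, $J_j$ the $j$-th column of $J$; $f=\sum_{T\subseteq[n]}\hat f(T)\chi_T$, $\chi_T(x)=\prod_{i\in T}x_i$. MRF neighborhood of $u$: all $i\ne u$ with $\hat f(T)\ne0$ for some $T\ni u,i$. $s$: max over $u$ of the number of latent $j$ with $J_{i,j}\ne0$ for some $i$ in the MRF neighborhood of $u$. $D$: max size of an MRF neighborhood; $\gamma=\max_u\sum_{T\ni u}|\hat f(T)|$. For disjoint $\{u\},I,S$: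 $\nu_{u,I|S}:=\mathbb{E}_{R,G}\big[\mathbb{E}_{X_S}|\mathbb{P}(X_u=R,X_I=G|X_S)-\mathbb{P}(X_u=R|X_S)\mathbb{P}(X_I=G|X_S)|\big]$, with $R,G$ independent uniform on $\{-1,1\}$ and $\{-1,1\}^{|I|}$, and all probabilities under the marginal of the RBM. *)

theory Defs
  imports Complex_Main "HOL-Library.FuncSet"
begin

text \<open>Observed variables are indexed by 0..<n, latent variables by 0..<m.
  Parameters: J i j (observed i, latent j), h i, g j.
  Configurations are elements of the finite set PiE {..<n} (\<lambda>_. {-1,1}).\<close>

definition cube :: "nat set \<Rightarrow> (nat \<Rightarrow> real) set" where
  "cube A = PiE A (\<lambda>_. {-1, 1})"

definition rho :: "real \<Rightarrow> real" where
  "rho t = ln (exp t + exp (- t))"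

definition rbm_weight :: "nat \<Rightarrow> nat \<Rightarrow> (nat \<Rightarrow> nat \<Rightarrow> real) \<Rightarrow> (nat \<Rightarrow> real) \<Rightarrow> (nat \<Rightarrow> real)
    \<Rightarrow> (nat \<Rightarrow> real) \<Rightarrow> (nat \<Rightarrow> real) \<Rightarrow> real" where
  "rbm_weight n m J h g x y =
     exp ((\<Sum>i<n. \<Sum>j<m. x i * J i j * y j) + (\<Sum>i<n. h i * x i) + (\<Sum>j<m. g j * y j))"

definition rbm_Z :: "nat \<Rightarrow> nat \<Rightarrow> (nat \<Rightarrow> nat \<Rightarrow> real) \<Rightarrow> (nat \<Rightarrow> real) \<Rightarrow> (nat \<Rightarrow> real) \<Rightarrow> real" where
  "rbm_Z n m J h g = (\<Sum>x\<in>cube {..<n}. \<Sum>y\<in>cube {..<m}. rbm_weight n m J h g x y)"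

definition rbm_marg :: "nat \<Rightarrow> nat \<Rightarrow> (nat \<Rightarrow> nat \<Rightarrow> real) \<Rightarrow> (nat \<Rightarrow> real) \<Rightarrow> (nat \<Rightarrow> real)
    \<Rightarrow> (nat \<Rightarrow> real) \<Rightarrow> real" where
  "rbm_marg n m J h g x = (\<Sum>y\<in>cube {..<m}. rbm_weight n m J h g x y) / rbm_Z n m J h g"

definition rbm_prob :: "nat \<Rightarrow> nat \<Rightarrow> (nat \<Rightarrow> nat \<Rightarrow> real) \<Rightarrow> (nat \<Rightarrow> real) \<Rightarrow> (nat \<Rightarrow> real)
    \<Rightarrow> (nat \<Rightarrow> real) set \<Rightarrow> real" where
  "rbm_prob n m J h g A = (\<Sum>x\<in>cube {..<n} \<inter> A. rbm_marg n m J h g x)"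

definition rbm_cprob :: "nat \<Rightarrow> nat \<Rightarrow> (nat \<Rightarrow> nat \<Rightarrow> real) \<Rightarrow> (nat \<Rightarrow> real) \<Rightarrow> (nat \<Rightarrow> real)
    \<Rightarrow> (nat \<Rightarrow> real) set \<Rightarrow> (nat \<Rightarrow> real) set \<Rightarrow> real" where
  "rbm_cprob n m J h g A B = rbm_prob n m J h g (A \<inter> B) / rbm_prob n m J h g B"

definition ev :: "nat set \<Rightarrow> (nat \<Rightarrow> real) \<Rightarrow> (nat \<Rightarrow> real) set" where
  "ev A a = {x. \<forall>i\<in>A. x i = a i}"

definition rbm_f :: "nat \<Rightarrow> nat \<Rightarrow> (nat \<Rightarrow> nat \<Rightarrow> real) \<Rightarrow> (nat \<Rightarrow> real) \<Rightarrow> (nat \<Rightarrow> real)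
    \<Rightarrow> (nat \<Rightarrow> real) \<Rightarrow> real" where
  "rbm_f n m J h g x = (\<Sum>j<m. rho ((\<Sum>i<n. J i j * x i) + g j)) + (\<Sum>i<n. h i * x i)"

definition chi :: "nat set \<Rightarrow> (nat \<Rightarrow> real) \<Rightarrow> real" where
  "chi T x = (\<Prod>i\<in>T. x i)"

definition fhat :: "nat \<Rightarrow> nat \<Rightarrow> (nat \<Rightarrow> nat \<Rightarrow> real) \<Rightarrow> (nat \<Rightarrow> real) \<Rightarrow> (nat \<Rightarrow> real)
    \<Rightarrow> nat set \<Rightarrow> real" where
  "fhat n m J h g T = (\<Sum>x\<in>cube {..<n}. rbm_f n m J h g x * chi T x) / 2 ^ n"

definition mrf_nbhd :: "nat \<Rightarrow> nat \<Rightarrow> (nat \<Rightarrow> nat \<Rightarrow> real) \<Rightarrow> (nat \<Rightarrow> real) \<Rightarrow> (nat \<Rightarrow> real)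
    \<Rightarrow> nat \<Rightarrow> nat set" where
  "mrf_nbhd n m J h g u = {i. i < n \<and> i \<noteq> u \<and>
      (\<exists>T. T \<subseteq> {..<n} \<and> u \<in> T \<and> i \<in> T \<and> fhat n m J h g T \<noteq> 0)}"

definition rbm_d :: "nat \<Rightarrow> nat \<Rightarrow> (nat \<Rightarrow> nat \<Rightarrow> real) \<Rightarrow> nat" where
  "rbm_d n m J = Max (insert 0 ((\<lambda>j. card {i. i < n \<and> J i j \<noteq> 0}) ` {..<m}))"

definition rbm_s :: "nat \<Rightarrow> nat \<Rightarrow> (nat \<Rightarrow> nat \<Rightarrow> real) \<Rightarrow> (nat \<Rightarrow> real) \<Rightarrow> (nat \<Rightarrow> real) \<Rightarrow> nat" where
  "rbm_s n m J h g = Max (insert 0 ((\<lambda>u. card {j. j < m \<and>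
      (\<exists>i\<in>mrf_nbhd n m J h g u. J i j \<noteq> 0)}) ` {..<n}))"

definition rbm_D :: "nat \<Rightarrow> nat \<Rightarrow> (nat \<Rightarrow> nat \<Rightarrow> real) \<Rightarrow> (nat \<Rightarrow> real) \<Rightarrow> (nat \<Rightarrow> real) \<Rightarrow> nat" where
  "rbm_D n m J h g = Max (insert 0 ((\<lambda>u. card (mrf_nbhd n m J h g u)) ` {..<n}))"

definition rbm_gamma :: "nat \<Rightarrow> nat \<Rightarrow> (nat \<Rightarrow> nat \<Rightarrow> real) \<Rightarrow> (nat \<Rightarrow> real) \<Rightarrow> (nat \<Rightarrow> real) \<Rightarrow> real" where
  "rbm_gamma n m J h g = Max (insert 0 ((\<lambda>u. \<Sum>T\<in>{T. T \<subseteq> {..<n} \<and> u \<in> T}. \<bar>fhat n m J h g T\<bar>) ` {..<n}))"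

text \<open>nu_{u,I|S}: R uniform on {-1,1}, G uniform on {-1,1}^I, X_S distributed as under the marginal.\<close>
definition rbm_nu :: "nat \<Rightarrow> nat \<Rightarrow> (nat \<Rightarrow> nat \<Rightarrow> real) \<Rightarrow> (nat \<Rightarrow> real) \<Rightarrow> (nat \<Rightarrow> real)
    \<Rightarrow> nat \<Rightarrow> nat set \<Rightarrow> nat set \<Rightarrow> real" where
  "rbm_nu n m J h g u I S =
    (\<Sum>r\<in>{-1, 1::real}. \<Sum>G\<in>cube I. (1 / 2) * (1 / 2 ^ card I) *
      (\<Sum>a\<in>cube S. rbm_prob n m J h g (ev S a) *
         \<bar>rbm_cprob n m J h g (ev {u} (\<lambda>_. r) \<inter> ev I G) (ev S a)
          - rbm_cprob n m J h g (ev {u} (\<lambda>_. r)) (ev S a) * rbm_cprob n m J h g (ev I G) (ev S a)\<bar>))"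

end

theory Submission
  imports Defs
begin

text \<open>
  Write \<open>f(x) = x\<^sub>u E(x) + \<dots>\<close>, so that \<open>X\<^sub>u\<close> has conditional mean \<open>tanh E(X)\<close> given all other
  observed variables, with \<open>\<bar>E\<bar> \<le> \<gamma>\<close>. Since \<open>tanh\<close> has slope at least \<open>e\<^bsup>-2\<gamma>\<^esup>\<close> on \<open>[-\<gamma>, \<gamma>]\<close>, the
  conditional covariance of \<open>X\<^sub>u\<close> and \<open>E(X)\<close> given \<open>X\<^sub>S\<close> is at least \<open>e\<^bsup>-2\<gamma>\<^esup>\<close> times the
  conditional variance of \<open>E(X)\<close>. Comparing the law of the at most \<open>D\<close> neighbors of \<open>u\<close> with the
  uniform law bounds the mean of this variance below by \<open>e\<^bsup>-2\<gamma>D\<^esup> \<zeta>\<^sup>2\<close>. Expanding \<open>E\<close> in characters,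
  whose coefficients sum to at most \<open>\<gamma>\<close> in absolute value, some \<open>\<chi>\<^sub>I(X)\<close> with \<open>\<bar>I\<bar> < d\<close> is
  correlated with \<open>X\<^sub>u\<close>.

  To shrink \<open>I\<close>, condition on the latent variables: \<open>\<chi>\<^sub>I(X)\<close> has conditional mean
  \<open>\<Prod>\<^sub>i t\<^sub>i(y)\<close> with \<open>\<bar>t\<^sub>i\<bar> \<le> 1\<close>, and the vector \<open>t(y)\<close> takes at most \<open>M = 2\<^sup>s\<close> values. On \<open>M\<close>
  points such a product is a linear combination of subproducts with fewer than \<open>M\<close> factors, whose
  coefficients have absolute sum at most \<open>(2\<bar>I\<bar> + 1)\<^bsup>M-1\<^esup>\<close>. Hence one of the corresponding
  subsets of \<open>I\<close> is still correlated with \<open>X\<^sub>u\<close>.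
\<close>

subsection \<open>Products over few points\<close>

lemma sum_Pow_insert:
  assumes "finite A" "i \<notin> A"
  shows "(\<Sum>B\<in>Pow (insert i A). f B) = (\<Sum>B\<in>Pow A. f B + f (insert i B))"
proof -
  have "inj_on (insert i) (Pow A)"
    using assms(2) by (intro inj_onI) (metis PowD insert_ident subsetD)
  then have "(\<Sum>B\<in>insert i ` Pow A. f B) = (\<Sum>B\<in>Pow A. f (insert i B))"
    by (simp add: sum.reindex)
  then show ?thesis
    using assms by (subst Pow_insert, subst sum.union_disjoint) (auto simp: sum.distrib)
qed

text \<open>Splitting off a factor \<open>p i = q i + (p i - q i)\<close> at a chosen point \<open>q\<close>, the second summand
  vanishes at \<open>q\<close> and only has to be expanded at the remaining points; this trades one factor for
  one point.\<close>
lemma prod_few_points_expansion: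
  fixes P :: "('a \<Rightarrow> real) set"
  assumes "finite P" "card P \<le> Suc k" "finite I" "\<And>p i. p \<in> P \<Longrightarrow> i \<in> I \<Longrightarrow> \<bar>p i\<bar> \<le> 1"
  shows "\<exists>c. (\<forall>p\<in>P. (\<Prod>i\<in>I. p i) = (\<Sum>A\<in>Pow I. c A * (\<Prod>i\<in>A. p i)))
           \<and> (\<forall>A. c A \<noteq> 0 \<longrightarrow> card A \<le> k) \<and> (\<Sum>A\<in>Pow I. \<bar>c A\<bar>) \<le> (2 * real (card I) + 1) ^ k"
  using assms(3,1,2,4)
proof (induction I arbitrary: P k rule: finite_induct)
  case empty
  show ?case by (rule exI[of _ "\<lambda>A. if A = {} then 1 else 0"]) auto
next
  case (insert i I)
  show ?case
  proof (cases "P = {}")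
    case True
    show ?thesis by (rule exI[of _ "\<lambda>A. 0"]) (use True in auto)
  next
    case False
    then obtain q where q: "q \<in> P" by auto
    show ?thesis
    proof (cases k)
      case 0
      then have P: "P = {q}"
        using q insert.prems by (metis One_nat_def card_1_singletonE card_0_eq empty_iff le_Suc_eq le_zero_eq singletonD)
      define c where "c A = (if A = {} then (\<Prod>j\<in>insert i I. q j) else 0)" for A :: "'a set"
      have "\<bar>\<Prod>j\<in>insert i I. q j\<bar> \<le> 1"
        unfolding abs_prod using insert.prems(3) q by (intro prod_le_1) auto
      moreover have "(\<Sum>A\<in>Pow (insert i I). c A * F A) = (\<Prod>j\<in>insert i I. q j) * F {}" for F
        unfolding c_def using insert.hyps(1) by (subst sum.remove[of _ "{}"]) (auto intro!: sum.neutral)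
      moreover have "(\<Sum>A\<in>Pow (insert i I). \<bar>c A\<bar>) = \<bar>\<Prod>j\<in>insert i I. q j\<bar>"
        unfolding c_def using insert.hyps(1) by (subst sum.remove[of _ "{}"]) (auto intro!: sum.neutral)
      moreover have "\<forall>A. c A \<noteq> 0 \<longrightarrow> card A \<le> k" by (auto simp: c_def)
      ultimately show ?thesis using P 0 by (intro exI[of _ c]) auto
    next
      case (Suc k')
      have bnd: "\<bar>p j\<bar> \<le> 1" if "p \<in> P" "j \<in> I" for p j using insert.prems(3) that by auto
      obtain c1 where c1: "\<And>p. p \<in> P \<Longrightarrow> (\<Prod>i\<in>I. p i) = (\<Sum>A\<in>Pow I. c1 A * (\<Prod>i\<in>A. p i))"
        "\<And>A. c1 A \<noteq> 0 \<Longrightarrow> card A \<le> k" "(\<Sum>A\<in>Pow I. \<bar>c1 A\<bar>) \<le> (2 * real (card I) + 1) ^ k"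
        using insert.IH[of P k] insert.prems bnd by blast
      have "card (P - {q}) \<le> Suc k'" using insert.prems q Suc by simp
      then obtain c2 where c2: "\<And>p. p \<in> P - {q} \<Longrightarrow> (\<Prod>i\<in>I. p i) = (\<Sum>A\<in>Pow I. c2 A * (\<Prod>i\<in>A. p i))"
        "\<And>A. c2 A \<noteq> 0 \<Longrightarrow> card A \<le> k'" "(\<Sum>A\<in>Pow I. \<bar>c2 A\<bar>) \<le> (2 * real (card I) + 1) ^ k'"
        using insert.IH[of "P - {q}" k'] insert.prems bnd by blast
      \<comment> \<open>Collects the terms without and with \<open>i\<close> in \<open>q i\<close>
        times the \<open>c1\<close> expansion plus \<open>p i - q i\<close> times the
        \<open>c2\<close> expansion.\<close>
      define c where "c A = (if i \<in> A then c2 (A - {i}) else q i * c1 A - q i * c2 A)" for A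
      have ins: "c (insert i A) = c2 A" "c A = q i * c1 A - q i * c2 A" "finite A" "i \<notin> A" if "A \<in> Pow I" for A
        using that insert.hyps by (auto simp: c_def finite_subset intro!: arg_cong[of _ _ c2])
      have qi: "\<bar>q i\<bar> \<le> 1" using insert.prems q by auto
      have "(\<Prod>i\<in>insert i I. p i) = (\<Sum>A\<in>Pow (insert i I). c A * (\<Prod>i\<in>A. p i))" if p: "p \<in> P" for p
      proof -
        have "(\<Sum>A\<in>Pow (insert i I). c A * (\<Prod>i\<in>A. p i))
            = (\<Sum>A\<in>Pow I. q i * (c1 A * (\<Prod>i\<in>A. p i)) + (p i - q i) * (c2 A * (\<Prod>i\<in>A. p i)))"
          unfolding sum_Pow_insert[OF insert.hyps]
          by (rule sum.cong) (simp_all add: ins algebra_simps)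
        also have "\<dots> = q i * (\<Prod>i\<in>I. p i) + (p i - q i) * (\<Sum>A\<in>Pow I. c2 A * (\<Prod>i\<in>A. p i))"
          using c1(1)[OF p] by (simp add: sum.distrib sum_distrib_left)
        also have "\<dots> = p i * (\<Prod>i\<in>I. p i)"
          using c2(1)[of p] p by (cases "p = q") (auto simp: algebra_simps)
        finally show ?thesis using insert.hyps by simp
      qed
      moreover have "card A \<le> k" if "c A \<noteq> 0" for A
      proof (cases "i \<in> A")
        case True
        then have "c2 (A - {i}) \<noteq> 0" using that by (simp add: c_def)
        then have "card (A - {i}) \<le> k'" by (rule c2(2))
        then show ?thesis using Suc True by (cases "finite A") auto
      next
        case False
        then have "c1 A \<noteq> 0 \<or> c2 A \<noteq> 0" using that by (auto simp: c_def)
        then show ?thesis using c1(2)[of A] c2(2)[of A] Suc by auto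
      qed
      moreover have "(\<Sum>A\<in>Pow (insert i I). \<bar>c A\<bar>) \<le> (2 * real (card (insert i I)) + 1) ^ k"
      proof -
        let ?x = "2 * real (card I) + 1"
        have *: "\<bar>q i * t\<bar> \<le> \<bar>t\<bar>" for t
          using qi by (simp add: abs_mult mult_left_le_one_le)
        have "(\<Sum>A\<in>Pow (insert i I). \<bar>c A\<bar>) \<le> (\<Sum>A\<in>Pow I. \<bar>c1 A\<bar> + 2 * \<bar>c2 A\<bar>)"
          unfolding sum_Pow_insert[OF insert.hyps]
        proof (rule sum_mono)
          fix A assume "A \<in> Pow I"
          then show "\<bar>c A\<bar> + \<bar>c (insert i A)\<bar> \<le> \<bar>c1 A\<bar> + 2 * \<bar>c2 A\<bar>"
            using ins[of A] *[of "c1 A"] *[of "c2 A"] by linarith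
        qed
        also have "\<dots> \<le> ?x ^ k + 2 * ?x ^ k'"
          using c1(3) c2(3) by (simp add: sum.distrib flip: sum_distrib_left)
        also have "\<dots> = (?x + 2) * ?x ^ k'" by (simp add: Suc algebra_simps)
        \<comment> \<open>One more index raises the base \<open>?x\<close> by exactly 2, the cost of
          the two copies of \<open>c2\<close>. This recursion dictates the base
          \<open>2 * card I + 1\<close>.\<close>
        also have "\<dots> \<le> (?x + 2) * (?x + 2) ^ k'" by (intro mult_left_mono power_mono) auto
        also have "\<dots> = (2 * real (card (insert i I)) + 1) ^ k"
          using insert.hyps by (simp add: Suc algebra_simps)
        finally show ?thesis .
      qed
      ultimately show ?thesis by blast
    qed
  qed
qed

text \<open>Weighted pigeonhole: if \<open>C * N a\<close> stayed below \<open>Q\<close> wherever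
  the weight is nonzero, summing would give a total below \<open>Q\<close>. It is applied with the
  absolute values of coefficients as weights; keeping \<open>w a \<noteq> 0\<close> ensures that the
  chosen term really occurs in the expansion.\<close>

lemma exists_large_term:
  fixes w N :: "'a \<Rightarrow> real"
  assumes fin: "finite A" and w: "\<And>a. a \<in> A \<Longrightarrow> 0 \<le> w a" and C: "(\<Sum>a\<in>A. w a) \<le> C"
    and Q: "0 < Q" "Q \<le> (\<Sum>a\<in>A. w a * N a)"
  shows "\<exists>a\<in>A. w a \<noteq> 0 \<and> Q \<le> C * N a"
proof (rule ccontr)
  assume "\<not> ?thesis"
  then have small: "C * N a < Q" if "a \<in> A" "w a \<noteq> 0" for a using that by force
  have "\<exists>a\<in>A. w a \<noteq> 0" using Q by (metis (no_types, lifting) mult_zero_left not_less sum.neutral)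
  then obtain b where b: "b \<in> A" "w b \<noteq> 0" by auto
  have "0 < w b" using w[of b] b by simp
  also have "w b \<le> (\<Sum>a\<in>A. w a)" using fin w b by (intro member_le_sum) auto
  finally have "0 < C" using C by simp
  have "C * (\<Sum>a\<in>A. w a * N a) = (\<Sum>a\<in>A. w a * (C * N a))" by (simp add: sum_distrib_left mult_ac)
  also have "\<dots> < (\<Sum>a\<in>A. w a * Q)"
  proof (rule sum_strict_mono_ex1[OF fin])
    show "\<forall>a\<in>A. w a * (C * N a) \<le> w a * Q"
    proof
      fix a assume "a \<in> A"
      then show "w a * (C * N a) \<le> w a * Q"
        using small[of a] w[of a] by (cases "w a = 0") (auto intro!: mult_left_mono)
    qed
    show "\<exists>a\<in>A. w a * (C * N a) < w a * Q"
      using b \<open>0 < w b\<close> small[of b] by (intro bexI[of _ b] mult_strict_left_mono) auto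
  qed
  also have "\<dots> \<le> C * Q" using C Q by (simp flip: sum_distrib_right)
  finally show False using Q \<open>0 < C\<close> by (simp add: mult_less_cancel_left)
qed

subsection \<open>Characters and flips on the cube\<close>

lemma finite_cube [simp]: "finite A \<Longrightarrow> finite (cube A)"
  unfolding cube_def by (rule finite_PiE) auto

lemma cubeD: "x \<in> cube A \<Longrightarrow> i \<in> A \<Longrightarrow> x i = -1 \<or> x i = 1"
  unfolding cube_def by (drule PiE_mem) auto

lemma cube_abs: "x \<in> cube A \<Longrightarrow> i \<in> A \<Longrightarrow> \<bar>x i\<bar> = 1"
  using cubeD by fastforce

lemma chi_abs: "x \<in> cube A \<Longrightarrow> T \<subseteq> A \<Longrightarrow> \<bar>chi T x\<bar> = 1"
  unfolding chi_def abs_prod by (rule prod.neutral) (auto dest: cube_abs)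

lemma chi_square: "x \<in> cube A \<Longrightarrow> T \<subseteq> A \<Longrightarrow> chi T x * chi T x = 1"
  using chi_abs[of x A T] by (metis abs_mult_self mult_1)

lemma chi_cong: "(\<And>i. i \<in> T \<Longrightarrow> x i = y i) \<Longrightarrow> chi T x = chi T y"
  unfolding chi_def by (rule prod.cong) auto

lemma chi_restrict [simp]: "chi T (restrict x T) = chi T x"
  by (rule chi_cong) auto

lemma restrict_cube: "x \<in> cube A \<Longrightarrow> B \<subseteq> A \<Longrightarrow> restrict x B \<in> cube B"
  by (auto simp: cube_def PiE_iff)

lemma cube_eqI: "x \<in> cube A \<Longrightarrow> y \<in> cube A \<Longrightarrow> (\<And>i. i \<in> A \<Longrightarrow> x i = y i) \<Longrightarrow> x = y"
  unfolding cube_def by (rule PiE_ext)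

text \<open>Sign changes play two roles: as symmetries of the cube they cancel odd sums, and
  averaging over \<open>flip A\<close> for all \<open>A \<subseteq> N\<close> resamples the
  coordinates in \<open>N\<close> uniformly.\<close>

definition flip :: "nat set \<Rightarrow> (nat \<Rightarrow> real) \<Rightarrow> nat \<Rightarrow> real" where
  "flip Z x = (\<lambda>i. if i \<in> Z then - x i else x i)"

lemma flip_flip [simp]: "flip Z (flip Z x) = x"
  by (auto simp: flip_def)

lemma flip_in_cube: "Z \<subseteq> A \<Longrightarrow> x \<in> cube A \<Longrightarrow> flip Z x \<in> cube A"
  by (auto simp: cube_def flip_def PiE_iff extensional_def)

lemma sum_cube_flip:
  assumes "Z \<subseteq> A"
  shows "(\<Sum>x\<in>cube A. F (flip Z x)) = (\<Sum>x\<in>cube A. F x)"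
  by (rule sum.reindex_bij_witness[of _ "flip Z" "flip Z"]) (use assms flip_in_cube in auto)

lemma sum_cube_odd:
  assumes "Z \<subseteq> A" "\<And>x. x \<in> cube A \<Longrightarrow> F (flip Z x) = - F x"
  shows "(\<Sum>x\<in>cube A. F x) = (0::real)"
proof -
  have "(\<Sum>x\<in>cube A. F x) = (\<Sum>x\<in>cube A. - F x)"
    using sum_cube_flip[OF assms(1), of F] assms(2) by simp
  then show ?thesis by (simp add: sum_negf)
qed

lemma chi_flip_notin: "i \<notin> T \<Longrightarrow> chi T (flip {i} x) = chi T x"
  by (rule chi_cong) (auto simp: flip_def)

lemma chi_flip_in:
  assumes "finite T" "i \<in> T"
  shows "chi T (flip {i} x) = - chi T x"
proof -
  have "chi T y = y i * chi (T - {i}) y" for y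
    unfolding chi_def using assms by (simp add: prod.remove)
  moreover have "chi (T - {i}) (flip {i} x) = chi (T - {i}) x" by (rule chi_flip_notin) simp
  ultimately show ?thesis by (simp add: flip_def)
qed

section \<open>Orthogonality of characters and Fourier inversion\<close>

text \<open>The sum over \<open>T\<close> factors into \<open>x i * z i + 1\<close>, which is 2
  where the points agree and 0 where they differ.\<close>

lemma sum_chi_chi:
  assumes "finite A" "x \<in> cube A" "z \<in> cube A"
  shows "(\<Sum>T\<in>Pow A. chi T x * chi T z) = (if x = z then 2 ^ card A else 0)"
proof -
  have "(\<Sum>T\<in>Pow A. chi T x * chi T z) = (\<Prod>i\<in>A. x i * z i + 1)"
    by (subst prod_add[OF assms(1)]) (simp add: chi_def prod.distrib)
  also have "\<dots> = (if x = z then 2 ^ card A else 0)"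
  proof (cases "x = z")
    case True
    then have "x i * z i + 1 = 2" if "i \<in> A" for i using that assms(2) cubeD by fastforce
    then show ?thesis using True by (simp add: prod_constant)
  next
    case False
    then obtain i where "i \<in> A" "x i \<noteq> z i" using cube_eqI assms by blast
    then have "i \<in> A" "x i * z i + 1 = 0"
      using cubeD[OF assms(2), of i] cubeD[OF assms(3), of i] by auto
    then show ?thesis using False assms(1) by (auto intro!: prod_zero)
  qed
  finally show ?thesis .
qed

lemma fourier_inversion:
  assumes "finite A" "x \<in> cube A"
  shows "F x = (\<Sum>T\<in>Pow A. (\<Sum>z\<in>cube A. F z * chi T z) / 2 ^ card A * chi T x)"
proof -
  have "(\<Sum>T\<in>Pow A. (\<Sum>z\<in>cube A. F z * chi T z) / 2 ^ card A * chi T x)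
      = (\<Sum>T\<in>Pow A. \<Sum>z\<in>cube A. F z / 2 ^ card A * (chi T x * chi T z))"
    by (simp add: sum_divide_distrib sum_distrib_right sum_distrib_left mult_ac)
  also have "\<dots> = (\<Sum>z\<in>cube A. F z / 2 ^ card A * (\<Sum>T\<in>Pow A. chi T x * chi T z))"
    by (subst sum.swap) (simp add: sum_distrib_left)
  also have "\<dots> = (\<Sum>z\<in>cube A. if x = z then F z else 0)"
    by (intro sum.cong) (auto simp: sum_chi_chi[OF assms(1,2)])
  also have "\<dots> = F x" using assms by simp
  finally show ?thesis by simp
qed

section \<open>The hyperbolic tangent as a conditional mean, and its slope\<close>

text \<open>A spin with density proportional to \<open>exp (x i * \<theta>)\<close> has mean
  \<open>tanh \<theta>\<close>. As \<theta> and \<psi> ignore coordinate \<open>i\<close>, the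
  difference of the two summands is odd under flipping it. This serves twice: conditioning on the
  other observed variables, and on the latent ones.\<close>

lemma sum_cube_tanh:
  assumes "i \<in> A" "\<And>x. x \<in> cube A \<Longrightarrow> \<theta> (flip {i} x) = \<theta> x" "\<And>x. x \<in> cube A \<Longrightarrow> \<psi> (flip {i} x) = \<psi> x"
  shows "(\<Sum>x\<in>cube A. x i * exp (x i * \<theta> x) * \<psi> x) = (\<Sum>x\<in>cube A. tanh (\<theta> x) * exp (x i * \<theta> x) * \<psi> x)"
proof -
  have Z: "{i} \<subseteq> A" using assms(1) by simp
  let ?D = "\<lambda>x. x i * exp (x i * \<theta> x) * \<psi> x - tanh (\<theta> x) * exp (x i * \<theta> x) * \<psi> x"
  have "?D (flip {i} x) = - ?D x" if x: "x \<in> cube A" for x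
  proof -
    have *: "exp t + exp (-t) \<noteq> 0" for t :: real by (smt (verit) exp_gt_zero)
    have "flip {i} x i = - x i" by (simp add: flip_def)
    moreover have "tanh t * (exp t + exp (-t)) = exp t - exp (-t)" for t :: real
      unfolding tanh_altdef using *[of t] by simp
    ultimately show ?thesis
      using cubeD[OF x assms(1)] assms(2,3)[OF x] by (auto simp: algebra_simps)
        (metis (no_types, opaque_lifting) distrib_left mult.assoc mult.commute)+
  qed
  from sum_cube_odd[of "{i}" A ?D, OF Z this] show ?thesis by (simp add: sum_subtractf)
qed

text \<open>By the mean value theorem, as the derivative is \<open>1 / cosh z ^ 2\<close> and
  \<open>cosh z\<close> is at most \<open>exp \<gamma>\<close> between \<open>s\<close> and
  \<open>t\<close>. The product form is symmetric in \<open>s\<close> and \<open>t\<close> and can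
  be averaged into a covariance.\<close>

lemma tanh_diff_lower:
  fixes s t \<gamma> :: real
  assumes "\<bar>s\<bar> \<le> \<gamma>" "\<bar>t\<bar> \<le> \<gamma>"
  shows "exp (-2 * \<gamma>) * (s - t)\<^sup>2 \<le> (tanh s - tanh t) * (s - t)"
proof -
  have *: "exp (-2 * \<gamma>) * (s - t) \<le> tanh s - tanh t" if "t < s" "\<bar>s\<bar> \<le> \<gamma>" "\<bar>t\<bar> \<le> \<gamma>" for s t :: real
  proof -
    have der: "(tanh has_real_derivative 1 - tanh x ^ 2) (at x)" for x :: real
      by (auto intro!: derivative_eq_intros)
    obtain z where z: "t < z" "z < s" "tanh s - tanh t = (s - t) * (1 - tanh z ^ 2)"
      using MVT2[OF \<open>t < s\<close> der] by blast
    have "\<bar>z\<bar> \<le> \<gamma>" using z that by linarith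
    have "cosh z \<le> exp \<bar>z\<bar>"
      by (cases "z \<ge> 0") (auto simp: cosh_field_def)
    also have "\<dots> \<le> exp \<gamma>" using \<open>\<bar>z\<bar> \<le> \<gamma>\<close> by simp
    finally have "cosh z ^ 2 \<le> exp \<gamma> ^ 2" by (intro power_mono) auto
    then have c: "cosh z ^ 2 \<le> exp (2 * \<gamma>)" by (simp add: exp_double)
    have "1 - tanh z ^ 2 = (cosh z ^ 2 - sinh z ^ 2) / cosh z ^ 2"
      by (simp add: tanh_def power_divide diff_divide_distrib)
    also have "\<dots> = 1 / cosh z ^ 2" by (simp add: hyperbolic_pythagoras)
    finally have "1 / exp (2 * \<gamma>) \<le> 1 - tanh z ^ 2" using c by (simp add: frac_le)
    then have "exp (-2 * \<gamma>) \<le> 1 - tanh z ^ 2" by (simp add: exp_minus field_simps)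
    then show ?thesis using z that by (simp add: mult.commute mult_left_mono)
  qed
  consider "t < s" | "s < t" | "s = t" by linarith
  then show ?thesis
  proof cases
    case 1
    then have "exp (-2 * \<gamma>) * (s - t) * (s - t) \<le> (tanh s - tanh t) * (s - t)"
      using *[OF 1 assms] by (intro mult_right_mono) auto
    then show ?thesis by (simp add: power2_eq_square)
  next
    case 2
    then have "exp (-2 * \<gamma>) * (t - s) * (t - s) \<le> (tanh t - tanh s) * (t - s)"
      using *[OF 2 assms(2,1)] by (intro mult_right_mono) auto
    then show ?thesis by (simp add: power2_eq_square algebra_simps)
  qed auto
qed


lemma flip_insert: "i \<notin> Z \<Longrightarrow> flip (insert i Z) x = flip {i} (flip Z x)"
  by (auto simp: flip_def)

text \<open>Pair each \<open>Z\<close> avoiding \<open>i\<close> with \<open>insert i Z\<close>.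
  Unlike \<open>sum_cube_odd\<close>, the coordinates outside \<open>N\<close> stay fixed.\<close>

lemma sum_flips_odd:
  assumes "finite A" "N \<subseteq> A" "i \<in> N" "x \<in> cube A"
    and odd: "\<And>z. z \<in> cube A \<Longrightarrow> H (flip {i} z) = - H z"
  shows "(\<Sum>Z\<in>Pow N. H (flip Z x)) = (0::real)"
proof -
  have "finite (N - {i})" using assms finite_subset by blast
  then have "(\<Sum>Z\<in>Pow (insert i (N - {i})). H (flip Z x)) =
      (\<Sum>Z\<in>Pow (N - {i}). H (flip Z x) + H (flip (insert i Z) x))"
    by (rule sum_Pow_insert) simp
  also have "\<dots> = 0"
  proof (rule sum.neutral, rule ballI)
    fix Z assume "Z \<in> Pow (N - {i})"
    then have "i \<notin> Z" "flip Z x \<in> cube A" using assms by (auto intro!: flip_in_cube)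
    then show "H (flip Z x) + H (flip (insert i Z) x) = 0" using odd by (simp add: flip_insert[of i Z])
  qed
  finally show ?thesis using assms(3) by (simp add: insert_absorb)
qed

text \<open>The events \<open>ev B b\<close> partition the cube, and the one containing
  \<open>x\<close> has \<open>b = restrict x B\<close>.\<close>

lemma sum_cube_ev:
  assumes "finite B" "B \<subseteq> A" "x \<in> cube A"
  shows "(\<Sum>b\<in>cube B. of_bool (x \<in> ev B b) * G b) = (G (restrict x B) :: real)"
proof -
  have "(x \<in> ev B b) \<longleftrightarrow> b = restrict x B" if "b \<in> cube B" for b
    using that restrict_cube[OF assms(3,2)] cube_eqI[of b B "restrict x B"]
    by (auto simp: ev_def)
  then have "(\<Sum>b\<in>cube B. of_bool (x \<in> ev B b) * G b) = (\<Sum>b\<in>cube B. if b = restrict x B then G b else 0)"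
    by (intro sum.cong) auto
  also have "\<dots> = G (restrict x B)" using restrict_cube[OF assms(3,2)] assms(1) by simp
  finally show ?thesis .
qed

lemma flip_in_ev_iff: "i \<notin> S \<Longrightarrow> flip {i} x \<in> ev S a \<longleftrightarrow> x \<in> ev S a"
  by (auto simp: ev_def flip_def)

lemma exp_rho: "exp (rho t) = exp t + exp (- t)"
  unfolding rho_def by (rule exp_ln) (smt (verit) exp_gt_zero)

lemma card_cube: "finite A \<Longrightarrow> card (cube A) = 2 ^ card A"
  unfolding cube_def by (simp add: card_PiE numeral_2_eq_2)

lemma flip_other: "u \<noteq> i \<Longrightarrow> flip {i} x u = x u"
  by (simp add: flip_def)

subsection \<open>The marginal of an RBM\<close>

locale rbm =
  fixes n m :: nat and J :: "nat \<Rightarrow> nat \<Rightarrow> real" and h g :: "nat \<Rightarrow> real"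
begin

abbreviation "X \<equiv> cube {..<n}"
abbreviation "Y \<equiv> cube {..<m}"
abbreviation "f \<equiv> rbm_f n m J h g"
abbreviation "fh \<equiv> fhat n m J h g"
abbreviation "nbhd \<equiv> mrf_nbhd n m J h g"
abbreviation "\<gamma> \<equiv> rbm_gamma n m J h g"
abbreviation "\<mu> \<equiv> rbm_marg n m J h g"
abbreviation "weight \<equiv> rbm_weight n m J h g"
abbreviation "Z \<equiv> rbm_Z n m J h g"

text \<open>For fixed \<open>x\<close> the weight is a product over the latent units, so summing out
  \<open>y\<close> gives one factor \<open>exp t + exp (- t)\<close> per unit, which is
  \<open>exp (rho t)\<close>.\<close>

lemma sum_weight: "(\<Sum>y\<in>Y. weight x y) = exp (f x)"
proof -
  let ?t = "\<lambda>j. (\<Sum>i<n. J i j * x i) + g j"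
  have w: "weight x y = exp (\<Sum>i<n. h i * x i) * (\<Prod>j<m. exp (y j * ?t j))" for y
  proof -
    have "(\<Sum>i<n. \<Sum>j<m. x i * J i j * y j) + (\<Sum>j<m. g j * y j) = (\<Sum>j<m. y j * ?t j)"
      by (subst sum.swap) (simp add: sum_distrib_left algebra_simps sum.distrib)
    then have "weight x y = exp ((\<Sum>i<n. h i * x i) + (\<Sum>j<m. y j * ?t j))"
      unfolding rbm_weight_def by (intro arg_cong[of _ _ exp]) linarith
    then show ?thesis by (simp add: exp_add exp_sum)
  qed
  have "(\<Sum>y\<in>Y. \<Prod>j<m. exp (y j * ?t j)) = (\<Prod>j<m. \<Sum>b\<in>{-1,1}. exp (b * ?t j))"
    unfolding cube_def by (rule prod_sum_PiE[symmetric]) auto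
  also have "\<dots> = (\<Prod>j<m. exp (rho (?t j)))" by (simp add: exp_rho add.commute)
  also have "\<dots> = exp (\<Sum>j<m. rho (?t j))" by (simp add: exp_sum)
  finally have "(\<Sum>y\<in>Y. \<Prod>j<m. exp (y j * ?t j)) = exp (\<Sum>j<m. rho (?t j))" .
  then show ?thesis unfolding w sum_distrib_left[symmetric] rbm_f_def by (simp add: exp_add)
qed

lemma Z_pos: "0 < Z"
proof -
  have "(\<lambda>i\<in>{..<n}. 1) \<in> X" by (auto simp: cube_def)
  then show ?thesis unfolding rbm_Z_def sum_weight by (intro sum_pos) auto
qed

lemma marg_eq: "\<mu> x = exp (f x) / Z"
  by (simp add: rbm_marg_def sum_weight)

lemma marg_pos: "0 < \<mu> x"
  using Z_pos by (simp add: marg_eq)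

lemma sum_marg: "(\<Sum>x\<in>X. \<mu> x) = 1"
  using Z_pos by (simp add: marg_eq rbm_Z_def sum_weight flip: sum_divide_distrib)

lemma fourier: "x \<in> X \<Longrightarrow> f x = (\<Sum>T\<in>Pow {..<n}. fh T * chi T x)"
  using fourier_inversion[of "{..<n}" x f] by (simp add: fhat_def)

section \<open>The effect of the other observed variables on one of them\<close>

text \<open>The coefficient of \<open>x u\<close> in the multilinear polynomial \<open>f\<close>,
  that is, half its discrete derivative in direction \<open>u\<close>; the E of the
  overview.\<close>

definition effect :: "nat \<Rightarrow> (nat \<Rightarrow> real) \<Rightarrow> real" where
  "effect u x = (\<Sum>T | T \<subseteq> {..<n} \<and> u \<in> T. fh T * chi (T - {u}) x)"

lemma finite_sets_containing [simp]: "finite {T. T \<subseteq> {..<n} \<and> u \<in> T}"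
  by (rule finite_subset[of _ "Pow {..<n}"]) auto

lemma f_split:
  assumes "u < n" "x \<in> X"
  shows "f x = x u * effect u x + (\<Sum>T | T \<subseteq> {..<n} \<and> u \<notin> T. fh T * chi T x)"
proof -
  have "Pow {..<n} = {T. T \<subseteq> {..<n} \<and> u \<in> T} \<union> {T. T \<subseteq> {..<n} \<and> u \<notin> T}" by auto
  moreover have "finite {T. T \<subseteq> {..<n} \<and> u \<notin> T}" by (rule finite_subset[of _ "Pow {..<n}"]) auto
  ultimately have "f x = (\<Sum>T | T \<subseteq> {..<n} \<and> u \<in> T. fh T * chi T x)
      + (\<Sum>T | T \<subseteq> {..<n} \<and> u \<notin> T. fh T * chi T x)"
    unfolding fourier[OF assms(2)] by (simp only:, subst sum.union_disjoint) auto
  moreover have "(\<Sum>T | T \<subseteq> {..<n} \<and> u \<in> T. fh T * chi T x) = x u * effect u x"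
    unfolding effect_def sum_distrib_left
  proof (rule sum.cong)
    fix T assume "T \<in> {T. T \<subseteq> {..<n} \<and> u \<in> T}"
    then have "chi T x = x u * chi (T - {u}) x"
      unfolding chi_def by (subst prod.remove[of _ u]) (auto intro: finite_subset)
    then show "fh T * chi T x = x u * (fh T * chi (T - {u}) x)" by simp
  qed simp
  ultimately show ?thesis by simp
qed

lemma effect_flip: "effect u (flip {u} x) = effect u x"
  unfolding effect_def by (rule sum.cong) (auto simp: chi_flip_notin)

lemma gamma_ge: "u < n \<Longrightarrow> (\<Sum>T | T \<subseteq> {..<n} \<and> u \<in> T. \<bar>fh T\<bar>) \<le> \<gamma>"
  unfolding rbm_gamma_def by (rule Max_ge) auto

lemma gamma_nonneg: "0 \<le> \<gamma>"
  unfolding rbm_gamma_def by (rule Max_ge) auto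

lemma effect_bound:
  assumes "u < n" "x \<in> X"
  shows "\<bar>effect u x\<bar> \<le> \<gamma>"
proof -
  have "\<bar>effect u x\<bar> \<le> (\<Sum>T | T \<subseteq> {..<n} \<and> u \<in> T. \<bar>fh T * chi (T - {u}) x\<bar>)"
    unfolding effect_def by (rule sum_abs)
  also have "\<dots> = (\<Sum>T | T \<subseteq> {..<n} \<and> u \<in> T. \<bar>fh T\<bar>)"
  proof (rule sum.cong)
    fix T assume "T \<in> {T. T \<subseteq> {..<n} \<and> u \<in> T}"
    then have "\<bar>chi (T - {u}) x\<bar> = 1" using assms by (intro chi_abs) auto
    then show "\<bar>fh T * chi (T - {u}) x\<bar> = \<bar>fh T\<bar>" by (simp add: abs_mult)
  qed simp
  also have "\<dots> \<le> \<gamma>" using gamma_ge[OF assms(1)] .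
  finally show ?thesis .
qed

lemma f_flip:
  assumes "u < n" "x \<in> X"
  shows "f (flip {u} x) = f x - 2 * x u * effect u x"
proof -
  have "flip {u} x \<in> X" using assms by (intro flip_in_cube) auto
  moreover have "(\<Sum>T | T \<subseteq> {..<n} \<and> u \<notin> T. fh T * chi T (flip {u} x))
      = (\<Sum>T | T \<subseteq> {..<n} \<and> u \<notin> T. fh T * chi T x)"
    by (rule sum.cong) (auto simp: chi_flip_notin)
  moreover have "flip {u} x u = - x u" by (simp add: flip_def)
  ultimately show ?thesis
    using f_split[OF assms] f_split[of u "flip {u} x"] assms effect_flip[of u x] by simp
qed

text \<open>By \<open>f_flip\<close> and \<open>effect_bound\<close>, each single flip changes
  \<open>f\<close> by at most \<open>2 * \<gamma>\<close>.\<close>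

lemma marg_flip:
  assumes "finite A" "A \<subseteq> {..<n}" "x \<in> X"
  shows "\<mu> (flip A x) \<le> exp (2 * \<gamma>) ^ card A * \<mu> x"
  using assms
proof (induction A rule: finite_induct)
  case empty
  then show ?case by (simp add: flip_def)
next
  case (insert u A)
  let ?z = "flip A x"
  have z: "?z \<in> X" using insert.prems by (intro flip_in_cube) auto
  have u: "u < n" using insert.prems by simp
  have "\<bar>2 * ?z u * effect u ?z\<bar> \<le> 2 * \<gamma>"
    using effect_bound[OF u z] cube_abs[OF z, of u] u by (simp add: abs_mult)
  then have "exp (f (flip {u} ?z)) \<le> exp (2 * \<gamma> + f ?z)"
    unfolding f_flip[OF u z] by simp
  then have "\<mu> (flip {u} ?z) \<le> exp (2 * \<gamma>) * \<mu> ?z"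
    using Z_pos by (simp add: marg_eq exp_add divide_right_mono)
  also have "\<dots> \<le> exp (2 * \<gamma>) * (exp (2 * \<gamma>) ^ card A * \<mu> x)"
    using insert.IH insert.prems by (intro mult_left_mono) auto
  finally show ?case using insert.hyps by (simp add: flip_insert[of u A])
qed

text \<open>Says that \<open>tanh (effect u x)\<close> is the conditional mean of coordinate
  \<open>u\<close> given all the others, phrased with test functions \<psi> that ignore
  \<open>u\<close> in place of conditional expectations.\<close>

lemma marg_tanh:
  assumes u: "u < n" and \<psi>: "\<And>x. x \<in> X \<Longrightarrow> \<psi> (flip {u} x) = \<psi> x"
  shows "(\<Sum>x\<in>X. \<mu> x * x u * \<psi> x) = (\<Sum>x\<in>X. \<mu> x * tanh (effect u x) * \<psi> x)"
proof -
  define r where "r x = exp (\<Sum>T | T \<subseteq> {..<n} \<and> u \<notin> T. fh T * chi T x) / Z * \<psi> x" for x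
  have r: "r (flip {u} x) = r x" if "x \<in> X" for x
  proof -
    have "(\<Sum>T | T \<subseteq> {..<n} \<and> u \<notin> T. fh T * chi T (flip {u} x))
        = (\<Sum>T | T \<subseteq> {..<n} \<and> u \<notin> T. fh T * chi T x)"
      by (rule sum.cong) (auto simp: chi_flip_notin)
    then show ?thesis using \<psi>[OF that] by (simp add: r_def)
  qed
  have "\<mu> x * \<psi> x = exp (x u * effect u x) * r x" if "x \<in> X" for x
    using f_split[OF u that] by (simp add: marg_eq exp_add r_def)
  then have "(\<Sum>x\<in>X. \<mu> x * c x * \<psi> x) = (\<Sum>x\<in>X. c x * exp (x u * effect u x) * r x)" for c
    by (intro sum.cong) (auto simp: mult_ac)
  then show ?thesis
    using sum_cube_tanh[of u "{..<n}" "effect u" r] u r by (simp add: effect_flip)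
qed

section \<open>Neighborhoods, variance of the effect, and degree of \<open>f\<close>\<close>

lemma nbhd_subset: "nbhd u \<subseteq> {..<n}"
  by (auto simp: mrf_nbhd_def)

lemma finite_nbhd [simp]: "finite (nbhd u)"
  using nbhd_subset finite_subset by blast

lemma fhat_support_nbhd: "T \<subseteq> {..<n} \<Longrightarrow> u \<in> T \<Longrightarrow> fh T \<noteq> 0 \<Longrightarrow> T - {u} \<subseteq> nbhd u"
  by (auto simp: mrf_nbhd_def)

text \<open>Resampling only the neighborhood already isolates the coefficient of \<open>T0\<close>,
  whatever the values outside it, because every set in the support containing \<open>u\<close> lies
  within the neighborhood and \<open>u\<close>.\<close>

lemma sum_flips_effect:
  assumes T0: "T0 \<subseteq> {..<n}" "u \<in> T0" "fh T0 \<noteq> 0" and x: "x \<in> X"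
  shows "(\<Sum>A\<in>Pow (nbhd u). effect u (flip A x) * chi (T0 - {u}) (flip A x)) = fh T0 * 2 ^ card (nbhd u)"
proof -
  have chi: "(\<Sum>A\<in>Pow (nbhd u). fh T * (chi (T - {u}) (flip A x) * chi (T0 - {u}) (flip A x)))
      = (if T = T0 then fh T0 * 2 ^ card (nbhd u) else 0)" if T: "T \<subseteq> {..<n}" "u \<in> T" for T
  proof -
    consider "T = T0" | "fh T = 0" "T \<noteq> T0" | "fh T \<noteq> 0" "T \<noteq> T0" by blast
    then show ?thesis
    proof cases
      case 1
      have "chi (T0 - {u}) (flip A x) * chi (T0 - {u}) (flip A x) = 1" if "A \<in> Pow (nbhd u)" for A
        using that nbhd_subset x T0 by (intro chi_square[of _ "{..<n}"] flip_in_cube) auto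
      then show ?thesis using 1 by (simp add: card_Pow)
    next
      case 3
      \<comment> \<open>A point where \<open>T\<close> and \<open>T0\<close> differ is a neighbor,
        as both coefficients are nonzero, and flipping it negates exactly one of the two
        characters.\<close>
      then obtain i where i: "i \<in> T \<and> i \<notin> T0 \<or> i \<in> T0 \<and> i \<notin> T" by blast
      then have "i \<in> nbhd u"
        using fhat_support_nbhd[OF T] fhat_support_nbhd[OF T0(1,2)] 3 T0(2,3) T(2) by blast
      have "i \<noteq> u" using i T(2) T0(2) by auto
      have fin: "finite (T - {u})" "finite (T0 - {u})" using T T0 finite_subset by blast+
      have "(\<Sum>A\<in>Pow (nbhd u). chi (T - {u}) (flip A x) * chi (T0 - {u}) (flip A x)) = 0"
      proof (rule sum_flips_odd[OF _ nbhd_subset \<open>i \<in> nbhd u\<close> x])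
        show "chi (T - {u}) (flip {i} z) * chi (T0 - {u}) (flip {i} z)
            = - (chi (T - {u}) z * chi (T0 - {u}) z)" for z
          using i fin \<open>i \<noteq> u\<close> by (auto simp: chi_flip_in chi_flip_notin)
      qed simp
      then show ?thesis using 3 by (simp flip: sum_distrib_left)
    qed simp
  qed
  have "(\<Sum>A\<in>Pow (nbhd u). effect u (flip A x) * chi (T0 - {u}) (flip A x))
      = (\<Sum>T | T \<subseteq> {..<n} \<and> u \<in> T. \<Sum>A\<in>Pow (nbhd u).
          fh T * (chi (T - {u}) (flip A x) * chi (T0 - {u}) (flip A x)))"
    unfolding effect_def sum_distrib_right by (subst sum.swap) (simp add: mult_ac)
  also have "\<dots> = (\<Sum>T | T \<subseteq> {..<n} \<and> u \<in> T. if T = T0 then fh T0 * 2 ^ card (nbhd u) else 0)"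
    by (rule sum.cong) (use chi in auto)
  also have "\<dots> = fh T0 * 2 ^ card (nbhd u)" using T0 by simp
  finally show ?thesis .
qed

text \<open>The function \<open>c\<close> stands for a conditional mean given variables other than
  \<open>i\<close>. Under uniform resampling of the neighborhood it is uncorrelated with the
  character of \<open>T0 - {u}\<close>, so the second moment of \<open>effect u - c\<close> is at
  least the squared coefficient. Passing to \<mu> costs \<open>exp (-2 * \<gamma>)\<close> per
  neighbor.\<close>

lemma effect_variance_lower:
  assumes T0: "T0 \<subseteq> {..<n}" "u \<in> T0" "fh T0 \<noteq> 0" and i: "i \<in> T0" "i \<noteq> u"
    and c: "\<And>x. x \<in> X \<Longrightarrow> c (flip {i} x) = c x"
  shows "exp (-2 * \<gamma>) ^ card (nbhd u) * (fh T0)\<^sup>2 \<le> (\<Sum>x\<in>X. \<mu> x * (effect u x - c x)\<^sup>2)"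
proof -
  let ?N = "nbhd u" and ?t = "fh T0" and ?chi = "chi (T0 - {u})"
  let ?K = "exp (-2 * \<gamma>) ^ card ?N / 2 ^ card ?N"
  define \<phi> where "\<phi> x = effect u x - c x" for x
  have iN: "i \<in> ?N" using fhat_support_nbhd[OF T0] i by auto
  have flipX: "flip A x \<in> X" if "A \<in> Pow ?N" "x \<in> X" for A x
    using that nbhd_subset by (intro flip_in_cube) auto
  have inner: "2 ^ card ?N * ?t\<^sup>2 \<le> (\<Sum>A\<in>Pow ?N. (\<phi> (flip A x))\<^sup>2)" if x: "x \<in> X" for x
  proof -
    have "(\<Sum>A\<in>Pow ?N. c (flip A x) * ?chi (flip A x)) = 0"
    proof (rule sum_flips_odd[OF _ nbhd_subset iN x])
      show "c (flip {i} z) * ?chi (flip {i} z) = - (c z * ?chi z)" if "z \<in> X" for z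
        using c[OF that] i T0(1) by (simp add: chi_flip_in finite_subset[of "T0" "{..<n}"])
    qed simp
    then have s: "(\<Sum>A\<in>Pow ?N. \<phi> (flip A x) * ?chi (flip A x)) = ?t * 2 ^ card ?N"
      using sum_flips_effect[OF T0 x] by (simp add: \<phi>_def left_diff_distrib sum_subtractf)
    \<comment> \<open>In place of Cauchy-Schwarz: expand the square of
      \<open>\<phi> * ?chi - ?t\<close>, using that the character squares to 1, and sum.\<close>
    have "2 ^ card ?N * ?t\<^sup>2 = 2 * ?t * (?t * 2 ^ card ?N) - 2 ^ card ?N * ?t\<^sup>2"
      by (simp add: power2_eq_square)
    also have "\<dots> = (\<Sum>A\<in>Pow ?N. 2 * ?t * (\<phi> (flip A x) * ?chi (flip A x)) - ?t\<^sup>2)"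
      unfolding sum_subtractf s[symmetric] by (simp add: card_Pow sum_distrib_left)
    also have "\<dots> \<le> (\<Sum>A\<in>Pow ?N. (\<phi> (flip A x))\<^sup>2)"
    proof (rule sum_mono)
      fix A assume "A \<in> Pow ?N"
      then have "?chi (flip A x) * ?chi (flip A x) = 1"
        using x T0 by (intro chi_square[of _ "{..<n}"] flipX) auto
      then have "(\<phi> (flip A x) * ?chi (flip A x) - ?t)\<^sup>2
          = (\<phi> (flip A x))\<^sup>2 - 2 * ?t * (\<phi> (flip A x) * ?chi (flip A x)) + ?t\<^sup>2"
        by (simp add: power2_diff power_mult_distrib power2_eq_square[of "?chi _"])
      then show "2 * ?t * (\<phi> (flip A x) * ?chi (flip A x)) - ?t\<^sup>2 \<le> (\<phi> (flip A x))\<^sup>2"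
        by (smt (verit) zero_le_power2)
    qed
    finally show ?thesis .
  qed
  have pointwise: "?K * (\<Sum>A\<in>Pow ?N. \<mu> (flip A x)) \<le> \<mu> x" if x: "x \<in> X" for x
  proof -
    have "(\<Sum>A\<in>Pow ?N. \<mu> (flip A x)) \<le> (\<Sum>A\<in>Pow ?N. exp (2 * \<gamma>) ^ card ?N * \<mu> x)"
    proof (rule sum_mono)
      fix A assume A: "A \<in> Pow ?N"
      then have fin: "finite A" "A \<subseteq> {..<n}" using nbhd_subset[of u] finite_subset[of A ?N] by auto
      have "\<mu> (flip A x) \<le> exp (2 * \<gamma>) ^ card A * \<mu> x" by (rule marg_flip[OF fin x])
      also have "\<dots> \<le> exp (2 * \<gamma>) ^ card ?N * \<mu> x"
        using A gamma_nonneg marg_pos[of x]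
        by (intro mult_right_mono power_increasing card_mono) auto
      finally show "\<mu> (flip A x) \<le> exp (2 * \<gamma>) ^ card ?N * \<mu> x" .
    qed
    then have "?K * (\<Sum>A\<in>Pow ?N. \<mu> (flip A x)) \<le> ?K * (2 ^ card ?N * (exp (2 * \<gamma>) ^ card ?N * \<mu> x))"
      by (intro mult_left_mono) (auto simp: card_Pow)
    also have "\<dots> = (exp (-2 * \<gamma>) * exp (2 * \<gamma>)) ^ card ?N * \<mu> x"
      by (simp add: power_mult_distrib)
    also have "\<dots> = \<mu> x" by (simp flip: exp_add)
    finally show ?thesis .
  qed
  have "exp (-2 * \<gamma>) ^ card ?N * ?t\<^sup>2 = ?K * (\<Sum>x\<in>X. \<mu> x * (2 ^ card ?N * ?t\<^sup>2))"
    using sum_marg by (simp flip: sum_distrib_right)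
  also have "\<dots> \<le> ?K * (\<Sum>x\<in>X. \<mu> x * (\<Sum>A\<in>Pow ?N. (\<phi> (flip A x))\<^sup>2))"
    using inner marg_pos by (intro mult_left_mono sum_mono) (auto simp: less_imp_le)
  \<comment> \<open>Writing \<open>x\<close> as a double flip lets the reindexing by
    \<open>flip A\<close> move the flip from \<phi> onto \<mu>, where \<open>pointwise\<close>
    applies.\<close>
  also have "\<dots> = ?K * (\<Sum>A\<in>Pow ?N. \<Sum>x\<in>X. \<mu> (flip A (flip A x)) * (\<phi> (flip A x))\<^sup>2)"
    unfolding sum_distrib_left[of "\<mu> _"] by (subst sum.swap) simp
  also have "\<dots> = ?K * (\<Sum>A\<in>Pow ?N. \<Sum>x\<in>X. \<mu> (flip A x) * (\<phi> x)\<^sup>2)"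
  proof -
    have "(\<Sum>x\<in>X. \<mu> (flip A (flip A x)) * (\<phi> (flip A x))\<^sup>2) = (\<Sum>x\<in>X. \<mu> (flip A x) * (\<phi> x)\<^sup>2)"
      if "A \<in> Pow ?N" for A
      using sum_cube_flip[of A "{..<n}" "\<lambda>x. \<mu> (flip A x) * (\<phi> x)\<^sup>2"] that nbhd_subset[of u] by blast
    then show ?thesis by simp
  qed
  also have "\<dots> = (\<Sum>x\<in>X. ?K * (\<Sum>A\<in>Pow ?N. \<mu> (flip A x)) * (\<phi> x)\<^sup>2)"
    by (subst sum.swap) (simp only: sum_distrib_left sum_distrib_right mult_ac)
  also have "\<dots> \<le> (\<Sum>x\<in>X. \<mu> x * (\<phi> x)\<^sup>2)"
    using pointwise by (intro sum_mono mult_right_mono) auto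
  finally show ?thesis by (simp add: \<phi>_def)
qed

lemma fhat_zero_of_flip_invariant:
  assumes "T \<subseteq> {..<n}" "i \<in> T" "\<And>x. x \<in> X \<Longrightarrow> F (flip {i} x) = F x"
  shows "(\<Sum>x\<in>X. F x * chi T x) = 0"
  using assms by (intro sum_cube_odd[of "{i}"]) (auto simp: chi_flip_in finite_subset[of T "{..<n}"])

text \<open>The term of latent unit \<open>j\<close> depends only on the observed variables joined
  to \<open>j\<close>, so it contributes to \<open>T\<close> only if all of \<open>T\<close> is
  joined to \<open>j\<close>. The linear terms have degree one, hence the condition
  \<open>2 \<le> card T\<close>.\<close>

lemma fhat_card_le:
  assumes T: "T \<subseteq> {..<n}" "fh T \<noteq> 0" "2 \<le> card T"
  shows "card T \<le> rbm_d n m J"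
proof -
  let ?r = "\<lambda>j x. rho ((\<Sum>i<n. J i j * x i) + g j)"
  have "\<exists>j<m. T \<subseteq> {i. i < n \<and> J i j \<noteq> 0}"
  proof (rule ccontr)
    assume no: "\<not> ?thesis"
    have 1: "(\<Sum>x\<in>X. ?r j x * chi T x) = 0" if j: "j < m" for j
    proof -
      obtain i where i: "i \<in> T" "J i j = 0" using no j T(1) by blast
      have "(\<Sum>k<n. J k j * flip {i} x k) = (\<Sum>k<n. J k j * x k)" for x
        using i by (intro sum.cong) (auto simp: flip_def)
      then show ?thesis using T(1) i by (intro fhat_zero_of_flip_invariant) auto
    qed
    have 2: "(\<Sum>x\<in>X. h k * x k * chi T x) = 0" for k
    proof -
      obtain i where i: "i \<in> T" "i \<noteq> k"
        using T(3) card_mono[of "{k}" T] by fastforce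
      show ?thesis using T(1) i by (intro fhat_zero_of_flip_invariant) (auto simp: flip_def)
    qed
    have "(\<Sum>x\<in>X. f x * chi T x) = (\<Sum>x\<in>X. \<Sum>j<m. ?r j x * chi T x) + (\<Sum>x\<in>X. \<Sum>k<n. h k * x k * chi T x)"
      by (simp add: rbm_f_def sum.distrib distrib_right sum_distrib_right)
    also have "\<dots> = (\<Sum>j<m. \<Sum>x\<in>X. ?r j x * chi T x) + (\<Sum>k<n. \<Sum>x\<in>X. h k * x k * chi T x)"
      by (intro arg_cong2[of _ _ _ _ "(+)"] sum.swap)
    finally have "fh T = 0" using 1 2 by (simp add: fhat_def)
    then show False using T(2) by simp
  qed
  then obtain j where j: "j < m" "T \<subseteq> {i. i < n \<and> J i j \<noteq> 0}" by blast
  have "card T \<le> card {i. i < n \<and> J i j \<noteq> 0}" using j by (intro card_mono) auto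
  also have "\<dots> \<le> rbm_d n m J" unfolding rbm_d_def using j by (intro Max_ge) auto
  finally show ?thesis .
qed

subsection \<open>Correlation with a neighbor\<close>

text \<open>Expectation of \<open>q\<close> on the event that the variables in \<open>S\<close>
  equal \<open>a\<close>, not divided by its probability \<open>mom S a (\<lambda>_. 1)\<close>.
  Without the division, summing over \<open>a\<close> gives a total expectation
  (\<open>sum_cube_mom\<close>).\<close>

definition mom :: "nat set \<Rightarrow> (nat \<Rightarrow> real) \<Rightarrow> ((nat \<Rightarrow> real) \<Rightarrow> real) \<Rightarrow> real" where
  "mom S a q = (\<Sum>x\<in>X. \<mu> x * of_bool (x \<in> ev S a) * q x)"

definition cov :: "nat set \<Rightarrow> (nat \<Rightarrow> real) \<Rightarrow> ((nat \<Rightarrow> real) \<Rightarrow> real) \<Rightarrow> ((nat \<Rightarrow> real) \<Rightarrow> real) \<Rightarrow> real" where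
  "cov S a p q = mom S a (\<lambda>x. p x * q x) / mom S a (\<lambda>_. 1)
     - mom S a p / mom S a (\<lambda>_. 1) * (mom S a q / mom S a (\<lambda>_. 1))"

text \<open>A stand-in for \<open>rbm_nu\<close> that fits Fourier expansions;
  \<open>dep_le_nu\<close> converts back at the end.\<close>

definition dep :: "nat set \<Rightarrow> nat \<Rightarrow> nat set \<Rightarrow> real" where
  "dep S u A = (\<Sum>a\<in>cube S. mom S a (\<lambda>_. 1) * \<bar>cov S a (\<lambda>x. x u) (chi A)\<bar>)"

lemma mom_cong:
  assumes "\<And>x. x \<in> X \<Longrightarrow> x \<in> ev S a \<Longrightarrow> p x = q x"
  shows "mom S a p = mom S a q"
  unfolding mom_def by (rule sum.cong) (use assms in auto)

lemma mom_sum: "mom S a (\<lambda>x. \<Sum>t\<in>B. q t x) = (\<Sum>t\<in>B. mom S a (q t))"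
  unfolding mom_def sum_distrib_left by (rule sum.swap)

lemma mom_scale: "mom S a (\<lambda>x. c * q x) = c * mom S a q"
  unfolding mom_def sum_distrib_left by (rule sum.cong) auto

lemma mom_diff: "mom S a (\<lambda>x. p x - q x) = mom S a p - mom S a q"
  unfolding mom_def by (simp add: right_diff_distrib sum_subtractf)

lemma mom_mono:
  assumes "\<And>x. x \<in> X \<Longrightarrow> p x \<le> q x"
  shows "mom S a p \<le> mom S a q"
  unfolding mom_def using assms marg_pos by (intro sum_mono mult_left_mono) (auto simp: less_imp_le)

lemma mom_pos:
  assumes "S \<subseteq> {..<n}" "a \<in> cube S"
  shows "0 < mom S a (\<lambda>_. 1)"
proof -
  let ?x = "\<lambda>i. if i \<in> S then a i else if i < n then 1 else undefined"
  have "?x \<in> X" using assms by (auto simp: cube_def PiE_iff extensional_def)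
  moreover have "?x \<in> ev S a" by (simp add: ev_def)
  ultimately have "0 < \<mu> ?x * of_bool (?x \<in> ev S a) * 1" using marg_pos[of ?x] by simp
  then show ?thesis
    unfolding mom_def using \<open>?x \<in> X\<close> marg_pos by (intro sum_pos2[of _ ?x]) (auto simp: less_imp_le)
qed

lemma sum_cube_mom:
  assumes "S \<subseteq> {..<n}"
  shows "(\<Sum>a\<in>cube S. mom S a (q a)) = (\<Sum>x\<in>X. \<mu> x * q (restrict x S) x)"
proof -
  have fin: "finite S" using assms finite_subset by blast
  have "(\<Sum>a\<in>cube S. mom S a (q a)) = (\<Sum>x\<in>X. \<mu> x * (\<Sum>a\<in>cube S. of_bool (x \<in> ev S a) * q a x))"
    unfolding mom_def sum_distrib_left by (subst sum.swap) (simp add: mult.assoc)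
  also have "\<dots> = (\<Sum>x\<in>X. \<mu> x * q (restrict x S) x)"
    by (rule sum.cong) (auto simp: sum_cube_ev[OF fin assms])
  finally show ?thesis .
qed

lemma prob_Int_ev: "rbm_prob n m J h g (A \<inter> ev S a) = mom S a (\<lambda>x. of_bool (x \<in> A))"
proof -
  have "mom S a (\<lambda>x. of_bool (x \<in> A)) = (\<Sum>x\<in>X. if x \<in> A \<inter> ev S a then \<mu> x else 0)"
    unfolding mom_def by (rule sum.cong) auto
  then show ?thesis unfolding rbm_prob_def by (simp add: sum.inter_restrict)
qed

lemma prob_ev: "rbm_prob n m J h g (ev S a) = mom S a (\<lambda>_. 1)"
  using prob_Int_ev[of UNIV S a] by simp

text \<open>Both \<open>x u\<close> and \<open>chi I\<close> are combinations of indicators with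
  coefficients of absolute value 1, and covariance is bilinear. The factor
  \<open>2 * 2 ^ card I\<close> undoes the uniform averaging over R and G in
  \<open>rbm_nu\<close>.\<close>

lemma dep_le_nu:
  assumes "u < n" "I \<subseteq> {..<n}"
  shows "dep S u I \<le> 2 * 2 ^ card I * rbm_nu n m J h g u I S"
proof -
  have finI: "finite I" using assms finite_subset by blast
  define P where "P a = mom S a (\<lambda>_. 1)" for a
  define mr where "mr a r = mom S a (\<lambda>x. of_bool (x u = r))" for a and r :: real
  define mG where "mG a G = mom S a (\<lambda>x. of_bool (x \<in> ev I G))" for a G
  define mrG where "mrG a r G = mom S a (\<lambda>x. of_bool (x u = r) * of_bool (x \<in> ev I G))" for a G and r :: real
  \<comment> \<open>The conditional covariance of the two indicators, whose absolute value is
    averaged in \<open>rbm_nu\<close>.\<close>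
  define \<delta> where "\<delta> a r G = mrG a r G / P a - mr a r / P a * (mG a G / P a)" for a r G
  have cr: "(\<Sum>r\<in>{-1,1}. r * of_bool (x u = r)) = x u" if "x \<in> X" for x
    using cubeD[OF that, of u] assms(1) by auto
  have cG: "(\<Sum>G\<in>cube I. chi I G * of_bool (x \<in> ev I G)) = chi I x" if "x \<in> X" for x
    using sum_cube_ev[OF finI assms(2) that, of "chi I"] by (simp add: mult.commute)
  have 1: "mom S a (\<lambda>x. x u) = (\<Sum>r\<in>{-1,1}. r * mr a r)" for a
  proof -
    have "mom S a (\<lambda>x. x u) = mom S a (\<lambda>x. \<Sum>r\<in>{-1,1}. r * of_bool (x u = r))"
      by (rule mom_cong) (use cr in simp)
    then show ?thesis by (simp only: mom_sum mom_scale mr_def)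
  qed
  have 2: "mom S a (chi I) = (\<Sum>G\<in>cube I. chi I G * mG a G)" for a
  proof -
    have "mom S a (chi I) = mom S a (\<lambda>x. \<Sum>G\<in>cube I. chi I G * of_bool (x \<in> ev I G))"
      by (rule mom_cong) (use cG in simp)
    then show ?thesis by (simp only: mom_sum mom_scale mG_def)
  qed
  have 3: "mom S a (\<lambda>x. x u * chi I x) = (\<Sum>r\<in>{-1,1}. \<Sum>G\<in>cube I. (r * chi I G) * mrG a r G)" for a
  proof -
    have "mom S a (\<lambda>x. x u * chi I x) = mom S a (\<lambda>x. \<Sum>r\<in>{-1,1}. \<Sum>G\<in>cube I.
        (r * chi I G) * (of_bool (x u = r) * of_bool (x \<in> ev I G)))"
    proof (rule mom_cong)
      fix x assume "x \<in> X"
      then have "x u * chi I x = (\<Sum>r\<in>{-1,1}. r * of_bool (x u = r)) * (\<Sum>G\<in>cube I. chi I G * of_bool (x \<in> ev I G))"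
        by (simp only: cr cG)
      then show "x u * chi I x = (\<Sum>r\<in>{-1,1}. \<Sum>G\<in>cube I. (r * chi I G) * (of_bool (x u = r) * of_bool (x \<in> ev I G)))"
        unfolding sum_product by (simp only: mult_ac)
    qed
    then show ?thesis by (simp only: mom_sum mom_scale mrG_def)
  qed
  have cov: "cov S a (\<lambda>x. x u) (chi I) = (\<Sum>r\<in>{-1,1}. \<Sum>G\<in>cube I. (r * chi I G) * \<delta> a r G)" for a
  proof -
    have "(\<Sum>r\<in>{-1,1}. \<Sum>G\<in>cube I. (r * chi I G) * \<delta> a r G)
        = (\<Sum>r\<in>{-1,1}. \<Sum>G\<in>cube I. (r * chi I G) * mrG a r G) / P a
          - (\<Sum>r\<in>{-1,1}. \<Sum>G\<in>cube I. (r * mr a r) * (chi I G * mG a G)) / (P a * P a)"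
      unfolding \<delta>_def sum_divide_distrib sum_subtractf[symmetric]
      by (intro sum.cong refl) (simp add: algebra_simps)
    then show ?thesis unfolding cov_def 1 2 3 P_def[symmetric] sum_product[symmetric] by simp
  qed
  have abs_cov: "\<bar>cov S a (\<lambda>x. x u) (chi I)\<bar> \<le> (\<Sum>r\<in>{-1,1}. \<Sum>G\<in>cube I. \<bar>\<delta> a r G\<bar>)" for a
  proof -
    have "\<bar>cov S a (\<lambda>x. x u) (chi I)\<bar> \<le> (\<Sum>r\<in>{-1,1}. \<Sum>G\<in>cube I. \<bar>(r * chi I G) * \<delta> a r G\<bar>)"
      unfolding cov by (rule order_trans[OF sum_abs]) (intro sum_mono sum_abs)
    also have "\<dots> = (\<Sum>r\<in>{-1,1}. \<Sum>G\<in>cube I. \<bar>\<delta> a r G\<bar>)"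
      by (intro sum.cong refl) (auto simp: abs_mult chi_abs[of _ I I])
    finally show ?thesis .
  qed
  have P_nonneg: "0 \<le> P a" for a
    unfolding P_def mom_def using marg_pos by (intro sum_nonneg) (auto simp: less_imp_le)
  have "2 * 2 ^ card I * rbm_nu n m J h g u I S
      = (\<Sum>r\<in>{-1,1}. \<Sum>G\<in>cube I. \<Sum>a\<in>cube S. P a * \<bar>\<delta> a r G\<bar>)"
  proof -
    have c1: "rbm_cprob n m J h g (ev {u} (\<lambda>_. r) \<inter> ev I G) (ev S a) = mrG a r G / P a" for r G a
    proof -
      have "mom S a (\<lambda>x. of_bool (x \<in> ev {u} (\<lambda>_. r) \<inter> ev I G)) = mrG a r G"
        unfolding mrG_def by (rule mom_cong) (auto simp: ev_def)
      then show ?thesis by (simp only: rbm_cprob_def prob_Int_ev prob_ev P_def)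
    qed
    have c2: "rbm_cprob n m J h g (ev {u} (\<lambda>_. r)) (ev S a) = mr a r / P a" for r a
    proof -
      have "mom S a (\<lambda>x. of_bool (x \<in> ev {u} (\<lambda>_. r))) = mr a r"
        unfolding mr_def by (rule mom_cong) (auto simp: ev_def)
      then show ?thesis by (simp only: rbm_cprob_def prob_Int_ev prob_ev P_def)
    qed
    have c3: "rbm_cprob n m J h g (ev I G) (ev S a) = mG a G / P a" for G a
      by (simp only: rbm_cprob_def prob_Int_ev prob_ev P_def mG_def)
    show ?thesis
      unfolding rbm_nu_def c1 c2 c3 \<delta>_def[symmetric] unfolding prob_ev P_def[symmetric] sum_distrib_left
      by (intro sum.cong refl) simp
  qed
  also have "\<dots> = (\<Sum>a\<in>cube S. P a * (\<Sum>r\<in>{-1,1}. \<Sum>G\<in>cube I. \<bar>\<delta> a r G\<bar>))"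
  proof -
    have "(\<Sum>r\<in>{-1,1}. \<Sum>G\<in>cube I. \<Sum>a\<in>cube S. P a * \<bar>\<delta> a r G\<bar>)
        = (\<Sum>r\<in>{-1,1}. \<Sum>a\<in>cube S. \<Sum>G\<in>cube I. P a * \<bar>\<delta> a r G\<bar>)"
      by (intro sum.cong refl sum.swap)
    also have "\<dots> = (\<Sum>a\<in>cube S. \<Sum>r\<in>{-1,1}. \<Sum>G\<in>cube I. P a * \<bar>\<delta> a r G\<bar>)"
      by (rule sum.swap)
    finally show ?thesis by (simp only: sum_distrib_left)
  qed
  also have "\<dots> \<ge> dep S u I"
    unfolding dep_def P_def[symmetric] using abs_cov P_nonneg by (intro sum_mono mult_left_mono)
  finally show ?thesis .
qed

section \<open>Conditional independence given the latent variables\<close>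

text \<open>The input to observed unit \<open>i\<close> from the latent configuration
  \<open>y\<close>; its \<open>tanh\<close> is the mean of that unit given \<open>y\<close>.\<close>

definition field :: "nat \<Rightarrow> (nat \<Rightarrow> real) \<Rightarrow> real" where
  "field i y = h i + (\<Sum>j<m. J i j * y j)"

lemma weight_eq:
  assumes "i < n"
  shows "weight x y = exp (x i * field i y)
    * exp ((\<Sum>k\<in>{..<n} - {i}. x k * field k y) + (\<Sum>j<m. g j * y j))"
proof -
  have "(\<Sum>k<n. \<Sum>j<m. x k * J k j * y j) + (\<Sum>k<n. h k * x k) = (\<Sum>k<n. x k * field k y)"
    by (simp add: field_def distrib_left sum.distrib sum_distrib_left mult_ac)
  also have "\<dots> = x i * field i y + (\<Sum>k\<in>{..<n} - {i}. x k * field k y)"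
    using assms by (intro sum.remove) auto
  finally show ?thesis unfolding rbm_weight_def by (simp flip: exp_add)
qed

lemma sum_weight_tanh:
  assumes i: "i < n" and \<psi>: "\<And>x. x \<in> X \<Longrightarrow> \<psi> (flip {i} x) = \<psi> x"
  shows "(\<Sum>x\<in>X. weight x y * \<psi> x * x i) = tanh (field i y) * (\<Sum>x\<in>X. weight x y * \<psi> x)"
proof -
  define r where "r x = exp ((\<Sum>k\<in>{..<n} - {i}. x k * field k y) + (\<Sum>j<m. g j * y j)) * \<psi> x" for x
  have r: "r (flip {i} x) = r x" if "x \<in> X" for x
  proof -
    have "(\<Sum>k\<in>{..<n} - {i}. flip {i} x k * field k y) = (\<Sum>k\<in>{..<n} - {i}. x k * field k y)"
      by (rule sum.cong) (auto simp: flip_def)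
    then show ?thesis using \<psi>[OF that] by (simp add: r_def)
  qed
  have w: "weight x y * \<psi> x = exp (x i * field i y) * r x" for x
    using weight_eq[OF i, of x y] by (simp add: r_def)
  show ?thesis
    using sum_cube_tanh[of i "{..<n}" "\<lambda>_. field i y" r] i r
    unfolding w by (simp add: sum_distrib_left mult_ac)
qed

text \<open>Conditional independence given \<open>y\<close>: factors are peeled off one at a time,
  the remaining character being absorbed into the test function.\<close>

lemma sum_weight_chi:
  assumes "finite A" "A \<subseteq> {..<n}" "\<And>i x. i \<in> A \<Longrightarrow> x \<in> X \<Longrightarrow> \<psi> (flip {i} x) = \<psi> x"
  shows "(\<Sum>x\<in>X. weight x y * (\<psi> x * chi A x)) = (\<Prod>i\<in>A. tanh (field i y)) * (\<Sum>x\<in>X. weight x y * \<psi> x)"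
  using assms
proof (induction A rule: finite_induct)
  case empty
  then show ?case by (simp add: chi_def)
next
  case (insert i A)
  have "chi (insert i A) x = chi A x * x i" for x
    using insert.hyps by (simp add: chi_def)
  then have "(\<Sum>x\<in>X. weight x y * (\<psi> x * chi (insert i A) x)) = (\<Sum>x\<in>X. weight x y * (\<psi> x * chi A x) * x i)"
    by (simp add: mult_ac)
  also have "\<dots> = tanh (field i y) * (\<Sum>x\<in>X. weight x y * (\<psi> x * chi A x))"
    using insert.prems insert.hyps by (intro sum_weight_tanh) (auto simp: chi_flip_notin)
  also have "\<dots> = (\<Prod>i\<in>insert i A. tanh (field i y)) * (\<Sum>x\<in>X. weight x y * \<psi> x)"
    using insert by simp
  finally show ?case .
qed

lemma sum_marg_chi:
  assumes "A \<subseteq> {..<n}" "\<And>i x. i \<in> A \<Longrightarrow> x \<in> X \<Longrightarrow> \<psi> (flip {i} x) = \<psi> x"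
  shows "(\<Sum>x\<in>X. \<mu> x * (\<psi> x * chi A x)) = (\<Sum>y\<in>Y. (\<Sum>x\<in>X. weight x y * \<psi> x) / Z * (\<Prod>i\<in>A. tanh (field i y)))"
proof -
  have fin: "finite A" using assms(1) finite_subset by blast
  have "(\<Sum>x\<in>X. \<mu> x * (\<psi> x * chi A x)) = (\<Sum>x\<in>X. \<Sum>y\<in>Y. weight x y * (\<psi> x * chi A x) / Z)"
    unfolding rbm_marg_def by (simp add: sum_distrib_right sum_divide_distrib)
  also have "\<dots> = (\<Sum>y\<in>Y. \<Sum>x\<in>X. weight x y * (\<psi> x * chi A x) / Z)" by (rule sum.swap)
  also have "\<dots> = (\<Sum>y\<in>Y. (\<Sum>x\<in>X. weight x y * \<psi> x) / Z * (\<Prod>i\<in>A. tanh (field i y)))"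
    using sum_weight_chi[OF fin assms] by (simp add: mult_ac flip: sum_divide_distrib)
  finally show ?thesis .
qed

text \<open>Given the latent variables, the observed ones are independent, and the means of those in the
  neighborhood of \<open>u\<close> take at most \<open>2 ^ s\<close> values jointly.\<close>
lemma dep_small_subset:
  assumes u: "u < n" and I: "I \<subseteq> nbhd u" "I \<inter> S = {}" and pos: "0 < dep S u I"
  shows "\<exists>A\<subseteq>I. card A \<le> 2 ^ rbm_s n m J h g - 1 \<and>
    dep S u I \<le> (2 * real (card I) + 1) ^ (2 ^ rbm_s n m J h g - 1) * dep S u A"
proof -
  let ?k = "2 ^ rbm_s n m J h g - 1 :: nat"
  define K where "K = {j. j < m \<and> (\<exists>i\<in>nbhd u. J i j \<noteq> 0)}"
  \<comment> \<open>The vector of conditional means, set to 0 off \<open>I\<close> so that equal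
    means on \<open>I\<close> give equal functions and can be counted.\<close>
  define tau where "tau y = (\<lambda>i. if i \<in> I then tanh (field i y) else 0)" for y
  have finI: "finite I" and In: "I \<subseteq> {..<n}" and uI: "u \<notin> I"
    using I nbhd_subset finite_subset[OF I(1)] by (auto simp: mrf_nbhd_def)
  have finK: "finite K" "K \<subseteq> {..<m}" by (auto simp: K_def)
  have "card K \<le> rbm_s n m J h g"
    unfolding rbm_s_def K_def using u by (intro Max_ge) auto
  have "tau y = tau (restrict y K)" for y
  proof -
    have "field i y = field i (restrict y K)" if "i \<in> I" for i
    proof -
      have "J i j * y j = J i j * restrict y K j" if "j < m" for j
        using that \<open>i \<in> I\<close> I by (auto simp: K_def)
      then have "(\<Sum>j<m. J i j * y j) = (\<Sum>j<m. J i j * restrict y K j)"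
        by (intro sum.cong) (simp_all only: lessThan_iff)
      then show ?thesis by (simp only: field_def)
    qed
    then show ?thesis by (auto simp: tau_def)
  qed
  \<comment> \<open>The means on \<open>I\<close> see \<open>y\<close> only through the latent units
    in \<open>K\<close>, which leaves at most \<open>2 ^ card K\<close> vectors.\<close>
  then have sub: "tau ` Y \<subseteq> tau ` cube K" using restrict_cube[OF _ finK(2)] by blast
  have "card (tau ` Y) \<le> card (tau ` cube K)" using sub finK by (intro card_mono) auto
  also have "\<dots> \<le> card (cube K)" using finK by (intro card_image_le) auto
  also have "\<dots> = 2 ^ card K" using finK by (simp add: card_cube)
  also have "\<dots> \<le> 2 ^ rbm_s n m J h g" using \<open>card K \<le> _\<close> by (intro power_increasing) auto
  also have "\<dots> = Suc ?k" by simp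
  finally have "card (tau ` Y) \<le> Suc ?k" .
  moreover have "\<bar>p i\<bar> \<le> 1" if "p \<in> tau ` Y" for p i
    using that tanh_real_bounds by (auto simp: tau_def abs_le_iff less_imp_le minus_le_iff)
  ultimately obtain c where c: "\<And>p. p \<in> tau ` Y \<Longrightarrow> (\<Prod>i\<in>I. p i) = (\<Sum>A\<in>Pow I. c A * (\<Prod>i\<in>A. p i))"
      "\<And>A. c A \<noteq> 0 \<Longrightarrow> card A \<le> ?k" "(\<Sum>A\<in>Pow I. \<bar>c A\<bar>) \<le> (2 * real (card I) + 1) ^ ?k"
    using prod_few_points_expansion[of "tau ` Y" ?k I] finI by auto
  have c': "(\<Prod>i\<in>I. tanh (field i y)) = (\<Sum>A\<in>Pow I. c A * (\<Prod>i\<in>A. tanh (field i y)))" if "y \<in> Y" for y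
  proof -
    have "(\<Prod>i\<in>A. tau y i) = (\<Prod>i\<in>A. tanh (field i y))" if "A \<subseteq> I" for A
      using that by (intro prod.cong) (auto simp: tau_def)
    then show ?thesis using c(1)[of "tau y"] that by simp
  qed
  \<comment> \<open>The coefficients \<open>c\<close> do not depend on \<open>y\<close>, so the
    expansion survives averaging over \<open>y\<close> against any \<psi> that ignores
    \<open>I\<close>. Below, \<psi> is the indicator of \<open>ev S a\<close>, with and without the
    factor \<open>x u\<close>.\<close>
  have lin: "(\<Sum>x\<in>X. \<mu> x * (\<psi> x * chi I x)) = (\<Sum>A\<in>Pow I. c A * (\<Sum>x\<in>X. \<mu> x * (\<psi> x * chi A x)))"
    if \<psi>: "\<And>i x. i \<in> I \<Longrightarrow> x \<in> X \<Longrightarrow> \<psi> (flip {i} x) = \<psi> x" for \<psi>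
  proof -
    let ?W = "\<lambda>y. (\<Sum>x\<in>X. weight x y * \<psi> x) / Z"
    have "(\<Sum>A\<in>Pow I. c A * (\<Sum>x\<in>X. \<mu> x * (\<psi> x * chi A x)))
        = (\<Sum>A\<in>Pow I. c A * (\<Sum>y\<in>Y. ?W y * (\<Prod>i\<in>A. tanh (field i y))))"
      using In \<psi> by (intro sum.cong refl arg_cong2[of _ _ _ _ "(*)"] sum_marg_chi) auto
    also have "\<dots> = (\<Sum>y\<in>Y. ?W y * (\<Sum>A\<in>Pow I. c A * (\<Prod>i\<in>A. tanh (field i y))))"
      unfolding sum_distrib_left by (subst sum.swap) (simp only: mult_ac)
    also have "\<dots> = (\<Sum>y\<in>Y. ?W y * (\<Prod>i\<in>I. tanh (field i y)))" using c' by simp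
    also have "\<dots> = (\<Sum>x\<in>X. \<mu> x * (\<psi> x * chi I x))" using In \<psi> by (intro sum_marg_chi[symmetric]) auto
    finally show ?thesis by simp
  qed
  have inv: "flip {i} x \<in> ev S a \<longleftrightarrow> x \<in> ev S a" "flip {i} x u = x u" if "i \<in> I" for i x a
    using that I(2) uI flip_in_ev_iff[of i S] flip_other[of u i] by blast+
  have mom1: "mom S a (\<lambda>x. x u * chi I x) = (\<Sum>A\<in>Pow I. c A * mom S a (\<lambda>x. x u * chi A x))" for a
    using lin[of "\<lambda>x. of_bool (x \<in> ev S a) * x u"] inv
    by (simp add: mom_def mult.assoc)
  have mom0: "mom S a (chi I) = (\<Sum>A\<in>Pow I. c A * mom S a (chi A))" for a
    using lin[of "\<lambda>x. of_bool (x \<in> ev S a)"] inv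
    by (simp add: mom_def mult.assoc)
  \<comment> \<open>The same \<open>c\<close> serves every \<open>a\<close>, so a single
    \<open>A\<close> can be chosen after summing over \<open>a\<close>.\<close>
  have cov: "cov S a (\<lambda>x. x u) (chi I) = (\<Sum>A\<in>Pow I. c A * cov S a (\<lambda>x. x u) (chi A))" for a
    unfolding cov_def mom1 mom0
    by (simp add: right_diff_distrib sum_subtractf sum_divide_distrib sum_distrib_left mult_ac)
  have "dep S u I \<le> (\<Sum>a\<in>cube S. \<Sum>A\<in>Pow I. mom S a (\<lambda>_. 1) * (\<bar>c A\<bar> * \<bar>cov S a (\<lambda>x. x u) (chi A)\<bar>))"
    unfolding dep_def
  proof (rule sum_mono)
    fix a
    have "0 \<le> mom S a (\<lambda>_. 1)"
      unfolding mom_def using marg_pos by (intro sum_nonneg) (auto simp: less_imp_le)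
    moreover have "\<bar>cov S a (\<lambda>x. x u) (chi I)\<bar> \<le> (\<Sum>A\<in>Pow I. \<bar>c A\<bar> * \<bar>cov S a (\<lambda>x. x u) (chi A)\<bar>)"
      unfolding cov abs_mult[symmetric] by (rule sum_abs)
    ultimately show "mom S a (\<lambda>_. 1) * \<bar>cov S a (\<lambda>x. x u) (chi I)\<bar>
        \<le> (\<Sum>A\<in>Pow I. mom S a (\<lambda>_. 1) * (\<bar>c A\<bar> * \<bar>cov S a (\<lambda>x. x u) (chi A)\<bar>))"
      unfolding sum_distrib_left[symmetric] by (rule mult_left_mono[rotated])
  qed
  also have "\<dots> = (\<Sum>A\<in>Pow I. \<bar>c A\<bar> * dep S u A)"
    unfolding dep_def sum_distrib_left by (subst sum.swap) (simp only: mult_ac)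
  finally have "dep S u I \<le> (\<Sum>A\<in>Pow I. \<bar>c A\<bar> * dep S u A)" .
  then have "\<exists>A\<in>Pow I. \<bar>c A\<bar> \<noteq> 0 \<and> dep S u I \<le> (2 * real (card I) + 1) ^ ?k * dep S u A"
    using c(3) finI pos by (intro exists_large_term) auto
  then show ?thesis using c(2) by auto
qed

section \<open>From the variance of the effect to a correlated set\<close>

text \<open>Let \<open>c\<close> be the conditional mean of the effect. Since
  \<open>effect u x - c\<close> has conditional mean 0, \<open>tanh c\<close> can be subtracted for
  free before applying \<open>tanh_diff_lower\<close>; \<open>marg_tanh\<close> then trades
  \<open>tanh (effect u x)\<close> for \<open>x u\<close>, as \<open>u\<close> is not in
  \<open>S\<close>.\<close>

lemma cov_effect_ge:
  assumes u: "u < n" and S: "S \<subseteq> {..<n} - {u}" and a: "a \<in> cube S"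
  shows "exp (-2 * \<gamma>) * mom S a (\<lambda>x. (effect u x - mom S a (effect u) / mom S a (\<lambda>_. 1))\<^sup>2)
    \<le> mom S a (\<lambda>_. 1) * cov S a (\<lambda>x. x u) (effect u)"
proof -
  define P where "P = mom S a (\<lambda>_. 1)"
  define c where "c = mom S a (effect u) / P"
  have P: "0 < P" unfolding P_def using S a by (intro mom_pos) auto
  have const: "mom S a (\<lambda>x. t) = t * P" for t
    using mom_scale[of S a t "\<lambda>_. 1"] by (simp add: P_def)
  have "mom S a (effect u) \<le> \<gamma> * P" "- \<gamma> * P \<le> mom S a (effect u)"
    unfolding const[symmetric] using effect_bound[OF u] by (force intro!: mom_mono simp: abs_le_iff)+
  then have c_bound: "\<bar>c\<bar> \<le> \<gamma>" using P by (simp add: c_def abs_le_iff field_simps)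
  have zero: "mom S a (\<lambda>x. effect u x - c) = 0"
    using P by (simp add: mom_diff const c_def)
  have uS: "u \<notin> S" using S by auto
  have flip: "of_bool (flip {u} x \<in> ev S a) * (effect u (flip {u} x) - c)
      = of_bool (x \<in> ev S a) * (effect u x - c)" for x
    using uS by (simp add: effect_flip flip_in_ev_iff)
  have "exp (-2 * \<gamma>) * mom S a (\<lambda>x. (effect u x - c)\<^sup>2)
      = mom S a (\<lambda>x. exp (-2 * \<gamma>) * (effect u x - c)\<^sup>2)" by (simp add: mom_scale)
  also have "\<dots> \<le> mom S a (\<lambda>x. (tanh (effect u x) - tanh c) * (effect u x - c))"
    by (rule mom_mono) (use tanh_diff_lower[OF effect_bound[OF u] c_bound] in simp)
  also have "\<dots> = mom S a (\<lambda>x. tanh (effect u x) * (effect u x - c)) - tanh c * mom S a (\<lambda>x. effect u x - c)"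
    unfolding left_diff_distrib mom_diff mom_scale ..
  also have "\<dots> = mom S a (\<lambda>x. x u * (effect u x - c))"
    using marg_tanh[OF u, of "\<lambda>x. of_bool (x \<in> ev S a) * (effect u x - c)"] flip
    by (simp add: zero) (simp add: mom_def mult_ac)
  also have "\<dots> = mom S a (\<lambda>x. x u * effect u x - c * x u)" by (simp add: algebra_simps)
  also have "\<dots> = mom S a (\<lambda>x. x u * effect u x) - c * mom S a (\<lambda>x. x u)"
    by (simp only: mom_diff mom_scale)
  also have "\<dots> = P * cov S a (\<lambda>x. x u) (effect u)"
    using P by (simp add: cov_def P_def[symmetric] c_def field_simps)
  finally show ?thesis by (simp add: P_def c_def)
qed

text \<open>Given the values \<open>a\<close> on \<open>S\<close>, the part of a character inside
  \<open>S\<close> is a constant sign and leaves the covariance.\<close>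

lemma cov_effect_expansion:
  assumes "a \<in> cube S"
  shows "cov S a (\<lambda>x. x u) (effect u)
    = (\<Sum>T | T \<subseteq> {..<n} \<and> u \<in> T. fh T * chi ((T - {u}) \<inter> S) a * cov S a (\<lambda>x. x u) (chi (T - {u} - S)))"
proof -
  let ?\<T> = "{T. T \<subseteq> {..<n} \<and> u \<in> T}"
  have mom: "mom S a (\<lambda>x. p x * effect u x) = (\<Sum>T\<in>?\<T>. fh T * chi ((T - {u}) \<inter> S) a * mom S a (\<lambda>x. p x * chi (T - {u} - S) x))" for p
  proof -
    have "mom S a (\<lambda>x. p x * effect u x) = mom S a (\<lambda>x. \<Sum>T\<in>?\<T>. fh T * chi ((T - {u}) \<inter> S) a * (p x * chi (T - {u} - S) x))"
    proof (rule mom_cong)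
      fix x assume x: "x \<in> ev S a"
      have "chi (T - {u}) x = chi ((T - {u}) \<inter> S) a * chi (T - {u} - S) x" if "T \<in> ?\<T>" for T
      proof -
        have "finite (T - {u})" using that finite_subset by blast
        then have "chi (T - {u}) x = chi ((T - {u}) \<inter> S) x * chi (T - {u} - S) x"
          unfolding chi_def by (rule prod.Int_Diff)
        moreover have "chi ((T - {u}) \<inter> S) x = chi ((T - {u}) \<inter> S) a"
          using x by (intro chi_cong) (auto simp: ev_def)
        ultimately show ?thesis by simp
      qed
      then show "p x * effect u x = (\<Sum>T\<in>?\<T>. fh T * chi ((T - {u}) \<inter> S) a * (p x * chi (T - {u} - S) x))"
        unfolding effect_def sum_distrib_left by (intro sum.cong refl) simp
    qed
    then show ?thesis by (simp only: mom_sum mom_scale)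
  qed
  show ?thesis
    using mom[of "\<lambda>x. x u"] mom[of "\<lambda>_. 1"] unfolding cov_def
    by (simp add: right_diff_distrib sum_subtractf sum_divide_distrib sum_distrib_left mult_ac)
qed

text \<open>Averages the two preceding facts over \<open>a\<close> and combines them with
  \<open>effect_variance_lower\<close>; the slope of \<open>tanh\<close> accounts for the
  \<open>Suc\<close> in the exponent.\<close>

lemma sum_dep_ge:
  assumes u: "u < n" and S: "S \<subseteq> {..<n} - {u}"
    and T0: "T0 \<subseteq> {..<n}" "u \<in> T0" "fh T0 \<noteq> 0" and i: "i \<in> T0" "i \<noteq> u" "i \<notin> S"
  shows "exp (-2 * \<gamma>) ^ Suc (card (nbhd u)) * (fh T0)\<^sup>2
    \<le> (\<Sum>T | T \<subseteq> {..<n} \<and> u \<in> T. \<bar>fh T\<bar> * dep S u (T - {u} - S))"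
proof -
  let ?\<T> = "{T. T \<subseteq> {..<n} \<and> u \<in> T}"
  define P where "P a = mom S a (\<lambda>_. 1)" for a
  define c where "c a = mom S a (effect u) / P a" for a
  have Sn: "S \<subseteq> {..<n}" using S by auto
  \<comment> \<open>As \<open>i\<close> is outside \<open>S\<close>, the conditional mean given the
    variables in \<open>S\<close> is unchanged by flipping \<open>i\<close>.\<close>
  have inv: "restrict (flip {i} x) S = restrict x S" for x
    using i by (auto simp: flip_def restrict_def)
  have "exp (-2 * \<gamma>) ^ card (nbhd u) * (fh T0)\<^sup>2 \<le> (\<Sum>x\<in>X. \<mu> x * (effect u x - c (restrict x S))\<^sup>2)"
    using T0 i inv by (intro effect_variance_lower) auto
  also have "\<dots> = (\<Sum>a\<in>cube S. mom S a (\<lambda>x. (effect u x - c a)\<^sup>2))"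
    by (rule sum_cube_mom[OF Sn, symmetric])
  finally have "exp (-2 * \<gamma>) ^ Suc (card (nbhd u)) * (fh T0)\<^sup>2
      \<le> exp (-2 * \<gamma>) * (\<Sum>a\<in>cube S. mom S a (\<lambda>x. (effect u x - c a)\<^sup>2))" by (simp add: mult.assoc)
  also have "\<dots> \<le> (\<Sum>a\<in>cube S. P a * cov S a (\<lambda>x. x u) (effect u))"
    unfolding sum_distrib_left using cov_effect_ge[OF u S] by (intro sum_mono) (simp add: P_def c_def)
  also have "\<dots> \<le> (\<Sum>a\<in>cube S. \<Sum>T\<in>?\<T>. \<bar>fh T\<bar> * (P a * \<bar>cov S a (\<lambda>x. x u) (chi (T - {u} - S))\<bar>))"
  proof (rule sum_mono)
    fix a assume a: "a \<in> cube S"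
    have P: "0 < P a" unfolding P_def using mom_pos[OF Sn a] .
    show "P a * cov S a (\<lambda>x. x u) (effect u)
        \<le> (\<Sum>T\<in>?\<T>. \<bar>fh T\<bar> * (P a * \<bar>cov S a (\<lambda>x. x u) (chi (T - {u} - S))\<bar>))"
      unfolding cov_effect_expansion[OF a] sum_distrib_left
    proof (rule sum_mono)
      fix T
      let ?v = "cov S a (\<lambda>x. x u) (chi (T - {u} - S))"
      have "\<bar>fh T * chi ((T - {u}) \<inter> S) a * ?v\<bar> = \<bar>fh T\<bar> * \<bar>?v\<bar>"
        using chi_abs[OF a, of "(T - {u}) \<inter> S"] by (simp add: abs_mult)
      then have "P a * (fh T * chi ((T - {u}) \<inter> S) a * ?v) \<le> P a * (\<bar>fh T\<bar> * \<bar>?v\<bar>)"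
        using P by (intro mult_left_mono) auto
      then show "P a * (fh T * chi ((T - {u}) \<inter> S) a * ?v) \<le> \<bar>fh T\<bar> * (P a * \<bar>?v\<bar>)"
        by (simp add: mult_ac)
    qed
  qed
  also have "\<dots> = (\<Sum>T\<in>?\<T>. \<bar>fh T\<bar> * dep S u (T - {u} - S))"
    unfolding dep_def P_def sum_distrib_left by (rule sum.swap)
  finally show ?thesis .
qed

text \<open>Two selections: first a set \<open>T\<close> in the Fourier support, with weights
  summing to at most \<gamma>, then a subset of \<open>T - {u} - S\<close> of size below
  \<open>M\<close>.\<close>

lemma exists_small_correlated_set:
  assumes u: "u < n" and S: "S \<subseteq> {..<n} - {u}" and "0 < \<zeta>"
    and T0: "T0 \<subseteq> {..<n}" "u \<in> T0" "\<zeta> \<le> \<bar>fh T0\<bar>" and i: "i \<in> T0" "i \<noteq> u" "i \<notin> S"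
  defines "M \<equiv> 2 ^ rbm_s n m J h g"
  shows "\<exists>I. I \<subseteq> nbhd u \<and> I \<inter> S = {} \<and> card I < M \<and> 0 < \<gamma> \<and> 2 \<le> rbm_d n m J \<and>
    \<zeta>\<^sup>2 * exp (-2 * \<gamma>) ^ Suc (rbm_D n m J h g) / \<gamma>
      \<le> (4 * real (rbm_d n m J)) ^ M * rbm_nu n m J h g u I S"
proof -
  let ?d = "rbm_d n m J" and ?\<T> = "{T. T \<subseteq> {..<n} \<and> u \<in> T}"
  let ?e = "exp (-2 * \<gamma>)" and ?Q = "exp (-2 * \<gamma>) ^ Suc (card (nbhd u)) * (fh T0)\<^sup>2"
  have "fh T0 \<noteq> 0" using \<open>0 < \<zeta>\<close> T0 by auto
  have "card {u, i} \<le> card T0" using T0 i by (intro card_mono) (auto intro: finite_subset)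
  then have "2 \<le> card T0" using i by simp
  then have d2: "2 \<le> ?d" using fhat_card_le[OF T0(1) \<open>fh T0 \<noteq> 0\<close>] by simp
  have Q: "0 < ?Q" using \<open>fh T0 \<noteq> 0\<close> by simp
  have "\<exists>T\<in>?\<T>. \<bar>fh T\<bar> \<noteq> 0 \<and> ?Q \<le> \<gamma> * dep S u (T - {u} - S)"
    using sum_dep_ge[OF u S T0(1,2) \<open>fh T0 \<noteq> 0\<close> i] Q gamma_ge[OF u]
    by (intro exists_large_term) auto
  then obtain T where T: "T \<subseteq> {..<n}" "u \<in> T" "fh T \<noteq> 0" "?Q \<le> \<gamma> * dep S u (T - {u} - S)" by auto
  define I0 where "I0 = T - {u} - S"
  have "0 < \<gamma> * dep S u I0" using Q T(4) by (simp add: I0_def)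
  then have \<gamma>: "0 < \<gamma>" and dep: "0 < dep S u I0"
    using gamma_nonneg by (auto simp: zero_less_mult_iff)
  have I0: "I0 \<subseteq> nbhd u" "I0 \<inter> S = {}" using fhat_support_nbhd[OF T(1-3)] by (auto simp: I0_def)
  have finT: "finite T" using T(1) finite_subset by blast
  have "card I0 \<le> card (T - {u})" unfolding I0_def using finT by (intro card_mono) auto
  also have "\<dots> = card T - 1" using T(2) finT by simp
  \<comment> \<open>\<open>fhat_card_le\<close> needs two elements; otherwise
    \<open>card T - 1\<close> is 0.\<close>
  also have "\<dots> \<le> ?d - 1" using fhat_card_le[OF T(1,3)] by (cases "2 \<le> card T") auto
  finally have cI0: "2 * real (card I0) + 1 \<le> 2 * real ?d" using d2 by linarith
  obtain A where A: "A \<subseteq> I0" "card A \<le> M - 1" "dep S u I0 \<le> (2 * real (card I0) + 1) ^ (M - 1) * dep S u A"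
    using dep_small_subset[OF u I0 dep] unfolding M_def by blast
  let ?\<nu> = "rbm_nu n m J h g u A S"
  have An: "A \<subseteq> {..<n}" using A(1) I0(1) nbhd_subset by blast
  have M: "0 < M" by (simp add: M_def)
  have "0 \<le> dep S u A"
    unfolding dep_def mom_def using marg_pos by (intro sum_nonneg mult_nonneg_nonneg) (auto simp: less_imp_le)
  also note dep_le_nu[OF u An, of S]
  finally have \<nu>: "0 \<le> ?\<nu>" by (simp add: zero_le_mult_iff power_le_zero_eq)
  have "dep S u A \<le> 2 ^ Suc (card A) * ?\<nu>" using dep_le_nu[OF u An, of S] by simp
  also have "\<dots> \<le> 2 ^ M * ?\<nu>"
    using A(2) M \<nu> by (intro mult_right_mono power_increasing) auto
  finally have "dep S u A \<le> 2 ^ M * ?\<nu>" .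
  then have "dep S u I0 \<le> (2 * real (card I0) + 1) ^ (M - 1) * (2 ^ M * ?\<nu>)"
    by (intro order_trans[OF A(3)] mult_left_mono) auto
  \<comment> \<open>Rounding \<open>M - 1\<close> up to \<open>M\<close> merges this power with
    \<open>2 ^ M\<close> into \<open>(4 * d) ^ M\<close>.\<close>
  also have "\<dots> \<le> (2 * real ?d) ^ M * (2 ^ M * ?\<nu>)"
  proof (rule mult_right_mono)
    have "(2 * real (card I0) + 1) ^ (M - 1) \<le> (2 * real ?d) ^ (M - 1)" using cI0 by (intro power_mono) auto
    also have "\<dots> \<le> (2 * real ?d) ^ M" using d2 by (intro power_increasing) auto
    finally show "(2 * real (card I0) + 1) ^ (M - 1) \<le> (2 * real ?d) ^ M" .
  qed (use \<nu> in auto)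
  also have "\<dots> = (2 * real ?d * 2) ^ M * ?\<nu>" by (simp only: power_mult_distrib mult.assoc)
  finally have dep_nu: "dep S u I0 \<le> (4 * real ?d) ^ M * ?\<nu>" by (simp add: mult.commute)
  have "card (nbhd u) \<le> rbm_D n m J h g" unfolding rbm_D_def using u by (intro Max_ge) auto
  then have "?e ^ Suc (rbm_D n m J h g) \<le> ?e ^ Suc (card (nbhd u))"
    using gamma_nonneg by (intro power_decreasing) auto
  moreover have "\<zeta>\<^sup>2 \<le> (fh T0)\<^sup>2" using \<open>0 < \<zeta>\<close> T0(3) by (metis abs_le_square_iff abs_of_pos)
  ultimately have "\<zeta>\<^sup>2 * ?e ^ Suc (rbm_D n m J h g) \<le> (fh T0)\<^sup>2 * ?e ^ Suc (card (nbhd u))"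
    by (intro mult_mono) auto
  also have "\<dots> \<le> \<gamma> * dep S u I0" using T(4) by (simp add: I0_def mult.commute)
  also have "\<dots> \<le> \<gamma> * ((4 * real ?d) ^ M * ?\<nu>)" using dep_nu \<gamma> by (intro mult_left_mono) auto
  finally have "\<zeta>\<^sup>2 * ?e ^ Suc (rbm_D n m J h g) / \<gamma> \<le> (4 * real ?d) ^ M * ?\<nu>"
    using \<gamma> by (simp add: pos_divide_le_eq mult_ac)
  moreover have "A \<subseteq> nbhd u" "A \<inter> S = {}" "card A < M" using A I0 M by auto
  ultimately show ?thesis using \<gamma> d2 by blast
qed

end

section \<open>Comparison of constants and conclusion\<close>

text \<open>The target differs from \<open>le\<close> only by factors at most 1: a power of
  \<open>1 / d\<close> with arbitrary exponent \<open>k\<close>, the quotient \<open>4 / ?B\<close>,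
  and surplus powers of \<open>exp (-2 * \<gamma>)\<close>.\<close>

lemma bound_simplification:
  fixes \<gamma> \<zeta> \<nu> :: real and d D M k :: nat
  assumes \<gamma>: "0 < \<gamma>" and d: "2 \<le> d"
    and le: "\<zeta>\<^sup>2 * exp (-2 * \<gamma>) ^ Suc D / \<gamma> \<le> (4 * real d) ^ M * \<nu>"
  shows "1 / (4 * real d) ^ M * (1 / real d) ^ k *
    (4 * \<zeta>\<^sup>2 * exp (-2 * \<gamma>) ^ (d + D - 1) /
      (real d ^ (4 * d) * 2 ^ (d + 1) * real (D choose (d - 1)) * \<gamma> * exp (2 * \<gamma>))) \<le> \<nu>"
proof -
  let ?e = "exp (-2 * \<gamma>)" and ?B = "real d ^ (4 * d) * 2 ^ (d + 1) * real (D choose (d - 1))"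
  let ?R = "\<zeta>\<^sup>2 * ?e ^ Suc D / \<gamma>"
  \<comment> \<open>The \<open>exp (2 * \<gamma>)\<close> in the denominator raises the exponent
    \<open>d + D - 1\<close> to \<open>d + D\<close>, which is at least
    \<open>Suc D\<close>.\<close>
  have "?e ^ (d + D) = ?e ^ (d + D - 1) * ?e"
    using d by (subst power_Suc2[symmetric]) simp
  then have "?e ^ (d + D) = ?e ^ (d + D - 1) / exp (2 * \<gamma>)"
    by (simp add: exp_minus divide_inverse)
  then have X: "4 * \<zeta>\<^sup>2 * ?e ^ (d + D - 1) / (?B * \<gamma> * exp (2 * \<gamma>)) = 4 / ?B * (\<zeta>\<^sup>2 * ?e ^ (d + D) / \<gamma>)"
    by simp
  have "4 / ?B \<le> 1"
  proof (cases "D choose (d - 1) = 0")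
    case False
    then have C: "1 \<le> real (D choose (d - 1))" by linarith
    have "(1::real) * 4 * 1 \<le> ?B"
    proof (intro mult_mono)
      show "(4::real) \<le> 2 ^ (d + 1)" using power_increasing[of 2 "d + 1" "2::real"] d by simp
    qed (use d C in auto)
    then show ?thesis by (simp add: divide_le_eq_1)
  next
    case True \<comment> \<open>\<open>D < d - 1\<close>: the claimed bound degenerates to \<open>0\<close>, since \<open>x / 0 = 0\<close>.\<close>
    then show ?thesis by (simp del: binomial_eq_0_iff)
  qed
  moreover have "\<zeta>\<^sup>2 * ?e ^ (d + D) / \<gamma> \<le> ?R"
    using \<gamma> d by (intro divide_right_mono mult_left_mono power_decreasing) auto
  ultimately have X_le: "4 / ?B * (\<zeta>\<^sup>2 * ?e ^ (d + D) / \<gamma>) \<le> 1 * ?R"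
    using \<gamma> by (intro mult_mono) auto
  have "(1 / real d) ^ k * (4 / ?B * (\<zeta>\<^sup>2 * ?e ^ (d + D) / \<gamma>)) \<le> 1 * (1 * ?R)"
    by (rule mult_mono[OF _ X_le]) (use d \<gamma> in \<open>auto intro!: power_le_one\<close>)
  also have "\<dots> \<le> (4 * real d) ^ M * \<nu>" using le by simp
  finally have "1 / (4 * real d) ^ M * ((1 / real d) ^ k * (4 / ?B * (\<zeta>\<^sup>2 * ?e ^ (d + D) / \<gamma>)))
      \<le> 1 / (4 * real d) ^ M * ((4 * real d) ^ M * \<nu>)"
    by (intro mult_left_mono) auto
  then show ?thesis unfolding X using d by (simp add: mult.assoc)
qed

text \<open>As \<nu> is meant for disjoint sets, the conclusion includes
  \<open>I \<inter> S = {}\<close>; that \<open>u\<close> is not in \<open>I\<close> follows from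
  the definition of the neighborhood.\<close>

theorem theorem7:
  fixes n m :: nat and J :: "nat \<Rightarrow> nat \<Rightarrow> real" and h g :: "nat \<Rightarrow> real"
    and \<zeta> :: real and u :: nat and S :: "nat set"
  assumes "\<zeta> > 0" and "u < n" and "S \<subseteq> {..<n} - {u}"
    and "\<exists>i\<in>mrf_nbhd n m J h g u. i \<notin> S \<and>
           (\<exists>T. T \<subseteq> {..<n} \<and> u \<in> T \<and> i \<in> T \<and> \<bar>fhat n m J h g T\<bar> \<ge> \<zeta>)"
  shows "\<exists>I. I \<subseteq> mrf_nbhd n m J h g u \<and> I \<inter> S = {} \<and> card I \<le> 2 ^ rbm_s n m J h g \<and>
    (let d = rbm_d n m J; s = rbm_s n m J h g; D = rbm_D n m J h g; \<gamma> = rbm_gamma n m J h g in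
     rbm_nu n m J h g u I S \<ge>
       1 / (4 * real d) ^ (2 ^ s) * (1 / real d) ^ (2 ^ s * (2 ^ s + 1)) *
       (4 * \<zeta> ^ 2 * exp (- 2 * \<gamma>) ^ (d + D - 1) /
        (real d ^ (4 * d) * 2 ^ (d + 1) * real (D choose (d - 1)) * \<gamma> * exp (2 * \<gamma>))))"
proof -
  obtain i T where i: "i \<in> mrf_nbhd n m J h g u" "i \<notin> S" "T \<subseteq> {..<n}" "u \<in> T" "i \<in> T"
      "\<zeta> \<le> \<bar>fhat n m J h g T\<bar>"
    using assms(4) by blast
  then have "i \<noteq> u" by (simp add: mrf_nbhd_def)
  from rbm.exists_small_correlated_set[OF assms(2,3,1) i(3,4,6,5) this i(2)]
  obtain I where I: "I \<subseteq> mrf_nbhd n m J h g u" "I \<inter> S = {}" "card I < 2 ^ rbm_s n m J h g"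
      "0 < rbm_gamma n m J h g" "2 \<le> rbm_d n m J"
      "\<zeta>\<^sup>2 * exp (-2 * rbm_gamma n m J h g) ^ Suc (rbm_D n m J h g) / rbm_gamma n m J h g
        \<le> (4 * real (rbm_d n m J)) ^ (2 ^ rbm_s n m J h g) * rbm_nu n m J h g u I S"
    by blast
  show ?thesis
    unfolding Let_def using I(1-3) bound_simplification[OF I(4-6)]
    by (intro exI[of _ I] conjI) (simp_all only: less_imp_le)
qed

end
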